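(* Let $A,B,C,D,E\in\widehat{\mathbb{F}_q^{*}}$ be such that, whenever $A$ is a square, $A\neq\varepsilon$, $B\neq\varepsilon$, $B^2\neq A$, $A\neq CD$ and $A\neq CE$. Then $$ {}_{5}F_4\!\left(\begin{array}{ccccc} A, & B, & C, & D, & E\\ & A\bar{B}, & A\bar{C}, & A\bar{D}, & A\bar{E}\end{array}\Big|\;1\right)_q^{\star} $$ equals $0$ if $A$ is not a square, and otherwise equals $$ \frac{g(\bar{A})g(\bar{A}DE)g(\bar{A}CD)g(\bar{A}CE)g(A\,\overline{CDE})}{g(\bar{A}C)g(\bar{A}D)g(\bar{A}E)\,q\,(A\,\overline{CDE})(-1)}\sum_{R^2=A}{}_{4}F_3\!\left(\begin{array}{cccc} R\bar{B}, & C, & D, & E\\ & R, & \bar{A}CDE, & A\bar{B}\end{array}\Big|\;1\right)_q^{\star} $$ $$ +\frac{g(\bar{A}DE)g(\bar{A}CD)g(\bar{A}CE)\,q}{g(C)g(D)g(E)g(\bar{A}C)g(\bar{A}D)g(\bar{A}E)}\;{}_{2}F_1\!\left(\begin{array}{cc} A, & B\\ & A\bar{B}\end{array}\Big|\;-1\right)_q^{\star} +\frac{q(q-1)\,\delta(\bar{A}DE)}{g(D)g(E)g(\bar{E})g(\bar{D})}\;{}_{3}F_2\!\left(\begin{array}{ccc} A, & B, & C\\ & A\bar{B}, & A\bar{C}\end{array}\Big|\;1\right)_q^{\star}. $$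
   Context: Let $q$ be a prime power and $\mathbb{F}_q$ the finite field with $q$ elements. $\widehat{\mathbb{F}_q^{*}}$ denotes the group of multiplicative characters of $\mathbb{F}_q^{*}$; every character $\chi$ (including the trivial character $\varepsilon$) is extended to $\mathbb{F}_q$ by $\chi(0):=0$. $\bar{\chi}$ denotes the inverse character, and juxtaposition denotes pointwise product of characters (e.g. $A\,\overline{CDE}=A(CDE)^{-1}$). Fix a non-trivial additive character $\theta$ of $\mathbb{F}_q$ and define the Gauss sum $g(\chi):=\sum_{x\in\mathbb{F}_q}\chi(x)\theta(x)$. For $A_0,\dots,A_n,B_1,\dots,B_n\in\widehat{\mathbb{F}_q^{*}}$ and $x\in\mathbb{F}_q$ define $$ {}_{n+1}F_n\!\left(\begin{array}{cccc} A_0, & A_1, & \dots, & A_n\\ & B_1, & \dots, & B_n\end{array}\Big|\;x\right)_q^{\star}:=\frac{1}{q-1}\sum_{\chi\in\widehat{\mathbb{F}_q^{*}}}\prod_{i=0}^{n}\frac{g(A_i\chi)}{g(A_i)}\prod_{j=1}^{n}\frac{g(\overline{B_j\chi})}{g(\overline{B_j})}\,g(\bar{\chi})\,\chi(-1)^{n+1}\chi(x). $$ $\delta(\chi)=1$ if $\chi=\varepsilon$ and $0$ otherwise. "$A$ is a square" means $A=S^2$ for some character $S$; $\sum_{R^2=A}$ denotes the sum over all characters $R$ with $R^2=A$.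
   Formalization: The formal theorem assumes q odd; for even q the stated formula fails, e.g. q=4 with A=B a character of order 3 and C=D=E=ε gives 10 on the left and 5 on the right. *)

theory Defs
  imports Complex_Main "HOL-Library.FuncSet" "HOL-Library.Cardinality"
begin

text \<open>The finite field with q elements is a type \<open>'a :: {field, finite}\<close>, with \<open>q = CARD('a)\<close>.
  A multiplicative character is stored as its extension by zero to the whole field.\<close>

typedef (overloaded) ('a :: "{field, finite}") mult_char =
  "{\<chi> :: 'a \<Rightarrow> complex. \<chi> 0 = 0 \<and> \<chi> 1 = 1 \<and> (\<forall>x y. \<chi> (x * y) = \<chi> x * \<chi> y)}"
  morphisms char_at Abs_mult_char
  by (rule exI[of _ "\<lambda>x. if x = 0 then 0 else 1"]) auto

setup_lifting type_definition_mult_char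

text \<open>The unit \<open>1\<close> of the following instance is the trivial character, with value 0 at 0.\<close>

instantiation mult_char :: ("{field, finite}") "{comm_monoid_mult, inverse}"
begin

lift_definition one_mult_char :: "'a mult_char" is "\<lambda>x. if x = 0 then 0 else 1"
  by auto

lift_definition times_mult_char :: "'a mult_char \<Rightarrow> 'a mult_char \<Rightarrow> 'a mult_char"
  is "\<lambda>\<chi> \<psi> x. \<chi> x * \<psi> x"
  by auto

lift_definition inverse_mult_char :: "'a mult_char \<Rightarrow> 'a mult_char"
  is "\<lambda>\<chi> x. inverse (\<chi> x)"
  by auto

definition divide_mult_char :: "'a mult_char \<Rightarrow> 'a mult_char \<Rightarrow> 'a mult_char" where
  "divide_mult_char \<chi> \<psi> = \<chi> * inverse \<psi>"

instance
proof
  fix \<chi> \<psi> \<phi> :: "'a mult_char"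
  show "\<chi> * \<psi> * \<phi> = \<chi> * (\<psi> * \<phi>)"
    by transfer (simp add: mult.assoc)
  show "\<chi> * \<psi> = \<psi> * \<chi>"
    by transfer (simp add: mult.commute)
  show "1 * \<chi> = \<chi>"
    by transfer auto
qed

end

lemma char_at_0 [simp]: "char_at \<chi> 0 = 0"
  by transfer simp

lemma char_at_1 [simp]: "char_at \<chi> 1 = 1"
  by transfer simp

lemma char_at_mult: "char_at \<chi> (x * y) = char_at \<chi> x * char_at \<chi> y"
  by transfer simp

lemma char_at_eq_0_iff [simp]: "char_at \<chi> x = 0 \<longleftrightarrow> x = 0"
proof
  assume *: "char_at \<chi> x = 0"
  show "x = 0"
  proof (rule ccontr)
    assume "x \<noteq> 0"
    then have "char_at \<chi> x * char_at \<chi> (inverse x) = 1"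
      by (simp flip: char_at_mult)
    with * show False by simp
  qed
qed simp

lemma mult_char_mult_inverse [simp]: "\<chi> * inverse \<chi> = (1 :: 'a :: {field, finite} mult_char)"
proof -
  have "char_at (\<chi> * inverse \<chi>) x = char_at 1 x" for x
    by (simp add: times_mult_char.rep_eq inverse_mult_char.rep_eq one_mult_char.rep_eq)
  then show ?thesis
    by (intro iffD1[OF char_at_inject] ext)
qed

lemma char_at_root_of_unity:
  fixes x :: "'a :: {field, finite}"
  assumes "x \<noteq> 0"
  shows "char_at \<chi> x ^ card (UNIV - {0 :: 'a}) = 1"
proof -
  let ?U = "UNIV - {0 :: 'a}"
  have "bij_betw ((*) x) ?U ?U"
    using assms by (intro bij_betwI[where g = "\<lambda>y. y / x"]) auto
  then have "(\<Prod>y\<in>?U. char_at \<chi> y) = (\<Prod>y\<in>?U. char_at \<chi> (x * y))"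
    by (rule prod.reindex_bij_betw[symmetric])
  also have "\<dots> = char_at \<chi> x ^ card ?U * (\<Prod>y\<in>?U. char_at \<chi> y)"
    by (simp add: char_at_mult prod.distrib)
  finally show ?thesis
    by simp
qed

instance mult_char :: ("{field, finite}") finite
proof
  let ?n = "card (UNIV - {0 :: 'a})"
  have "0 < ?n"
  proof -
    have "(1 :: 'a) \<in> UNIV - {0}" by simp
    then show ?thesis by (metis card_gt_0_iff empty_iff finite)
  qed
  then have "finite (insert 0 {z :: complex. z ^ ?n = 1})"
    using finite_roots_unity[of ?n, where 'a = complex] by simp
  then have "finite ((UNIV :: 'a set) \<rightarrow>\<^sub>E insert 0 {z :: complex. z ^ ?n = 1})"
    by (intro finite_PiE) simp_all
  moreover have "range (char_at :: 'a mult_char \<Rightarrow> _) \<subseteq>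
      (UNIV :: 'a set) \<rightarrow>\<^sub>E insert 0 {z :: complex. z ^ ?n = 1}"
  proof (rule image_subsetI)
    fix \<chi> :: "'a mult_char"
    have "char_at \<chi> x \<in> insert 0 {z :: complex. z ^ ?n = 1}" for x
      using char_at_root_of_unity[of x \<chi>]
      by (cases "x = 0") (simp_all only: char_at_0 insert_iff mem_Collect_eq not_False_eq_True simp_thms)
    then show "char_at \<chi> \<in> (UNIV :: 'a set) \<rightarrow>\<^sub>E insert 0 {z :: complex. z ^ ?n = 1}"
      by (simp only: PiE_iff extensional_UNIV UNIV_I simp_thms ball_UNIV)
  qed
  ultimately have "finite (range (char_at :: 'a mult_char \<Rightarrow> _))"
    by (rule rev_finite_subset)
  moreover have "inj (char_at :: 'a mult_char \<Rightarrow> _)"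
    by (simp add: inj_on_def char_at_inject)
  ultimately show "finite (UNIV :: 'a mult_char set)"
    by (rule finite_imageD)
qed

definition additive_char :: "('a :: {field, finite} \<Rightarrow> complex) \<Rightarrow> bool" where
  "additive_char \<theta> \<longleftrightarrow> \<theta> 0 = 1 \<and> (\<forall>x y. \<theta> (x + y) = \<theta> x * \<theta> y)"

definition gauss_sum :: "('a :: {field, finite} \<Rightarrow> complex) \<Rightarrow> 'a mult_char \<Rightarrow> complex" where
  "gauss_sum \<theta> \<chi> = (\<Sum>x\<in>UNIV. char_at \<chi> x * \<theta> x)"

definition char_delta :: "'a :: {field, finite} mult_char \<Rightarrow> complex" where
  "char_delta \<chi> = (if \<chi> = 1 then 1 else 0)"

text \<open>The upper parameters \<open>A\<^sub>0, \<dots>, A\<^sub>n\<close> and the lower parameters \<open>B\<^sub>1, \<dots>, B\<^sub>n\<close> are given as lists;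
  the definition is meant for \<open>length As = length Bs + 1\<close>.\<close>

definition hypergeom_star ::
  "('a :: {field, finite} \<Rightarrow> complex) \<Rightarrow> 'a mult_char list \<Rightarrow> 'a mult_char list \<Rightarrow> 'a \<Rightarrow> complex" where
  "hypergeom_star \<theta> As Bs x =
     1 / (of_nat CARD('a) - 1) *
     (\<Sum>\<chi>\<in>UNIV.
        (\<Prod>A\<leftarrow>As. gauss_sum \<theta> (A * \<chi>) / gauss_sum \<theta> A) *
        (\<Prod>B\<leftarrow>Bs. gauss_sum \<theta> (inverse (B * \<chi>)) / gauss_sum \<theta> (inverse B)) *
        gauss_sum \<theta> (inverse \<chi>) * char_at \<chi> (- 1) ^ (length Bs + 1) * char_at \<chi> x)"

end

theory Submission
  imports Defs "HOL-Algebra.Multiplicative_Group"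
begin

text \<open>
  The summand of the well-poised series is, up to a constant, \<chi>(-1) times the product of
  g(A \<chi>) g(1/\<chi>) and of h_X = g(X \<chi>) g(X / (A \<chi>)) for X = B, C, D, E. Replacing \<chi> by 1/(A \<chi>)
  multiplies it by A(-1), which is -1 when A is not a square, so the sum vanishes.

  For square A, an analogue of the second Barnes lemma writes h_C h_D h_E as a sum over \<psi> of a
  coefficient times g(\<chi>/\<psi>) g(1/(A \<chi> \<psi>)), plus a constant, plus a multiple of h_C when A = D E. The
  constant yields the 2F1 at -1 and the multiple of h_C yields the 3F2. In the remaining term the sum
  over \<chi> is evaluated by an analogue of Dixon's theorem, which produces the sum over R with R^2 = A and
  leaves the 4F3 in \<psi>. Dixon's theorem follows from Kummer's by inserting the first Barnes lemma
  twice, and the second Barnes lemma follows from the first by evaluating a double sum in two ways.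
\<close>

section \<open>Multiplicative characters\<close>

text \<open>Gauss sums act as gamma functions and sums over characters as Mellin-Barnes integrals.
  The reflection formula is g(\<chi>) g(1/\<chi>) = q \<chi>(-1), and it fails only at the trivial
  character, where the product is 1. This exception shapes the proof: the summation formulas are
  applied inside sums over an auxiliary character, which runs through the exceptional values too, so
  these are carried along as explicit \<open>char_delta\<close> terms. Two of them survive. In the
  second Barnes lemma a delta at a single value of the auxiliary character leaves the constant, and
  a delta at D E e f = 1 leaves the term for A = D E. The others cancel in pairs or vanish, and the
  conditions on the parameters serve this: A nontrivial removes a constant in Dixon's theorem, B
  nontrivial and B^2 different from A permit reflection at B and at B/R for R^2 = A, and A different
  from C D and C E permits it at C D/A and C E/A. Oddness of q separates 1 from -1, so that A has
  exactly 1 + A(-1) square roots.\<close>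

lemma mult_char_eqI:
  assumes "\<And>x. x \<noteq> 0 \<Longrightarrow> char_at \<chi> x = char_at \<psi> x"
  shows "\<chi> = \<psi>"
proof -
  have "char_at \<chi> x = char_at \<psi> x" for x
    using assms by (cases "x = 0") auto
  then show ?thesis
    by (intro iffD1[OF char_at_inject] ext)
qed

lemma char_at_one: "char_at 1 x = (if x = 0 then 0 else 1)"
  by transfer simp

lemma char_at_times: "char_at (\<chi> * \<psi>) x = char_at \<chi> x * char_at \<psi> x"
  by transfer simp

lemma char_at_inverse: "char_at (inverse \<chi>) x = inverse (char_at \<chi> x)"
  by transfer simp

lemma char_at_power: "x \<noteq> 0 \<Longrightarrow> char_at (\<chi> ^ n) x = char_at \<chi> x ^ n"
  by (induction n) (auto simp: char_at_one char_at_times)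

lemma char_at_of_inverse: "char_at \<chi> (inverse x) = inverse (char_at \<chi> x)"
proof (cases "x = 0")
  case False
  then have "char_at \<chi> x * char_at \<chi> (inverse x) = 1"
    by (simp flip: char_at_mult)
  then show ?thesis
    by (simp add: inverse_unique)
qed simp

lemma char_at_of_power: "char_at \<chi> (x ^ n) = char_at \<chi> x ^ n"
  by (induction n) (auto simp: char_at_mult)

lemma char_at_minus_one_squared: "char_at \<chi> (- 1) * char_at \<chi> (- 1) = 1"
  by (simp flip: char_at_mult)

lemma char_at_minus: "char_at \<chi> (- x) = char_at \<chi> (- 1) * char_at \<chi> x"
  by (simp flip: char_at_mult)

lemma inverse_char_at_minus_one: "inverse (char_at \<chi> (- 1)) = char_at \<chi> (- 1)"
  using char_at_minus_one_squared inverse_unique by blast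

lemma inverse_mult_char_inverse [simp]: "inverse (inverse \<chi>) = (\<chi> :: 'a :: {field, finite} mult_char)"
  by (rule mult_char_eqI) (simp add: char_at_inverse)

lemma inverse_mult_char_one [simp]: "inverse 1 = (1 :: 'a :: {field, finite} mult_char)"
  by (rule mult_char_eqI) (simp add: char_at_inverse char_at_one)

lemma inverse_mult_char_mult:
  "inverse (\<chi> * \<psi>) = inverse \<chi> * (inverse \<psi> :: 'a :: {field, finite} mult_char)"
  by (rule mult_char_eqI) (simp add: char_at_inverse char_at_times)

lemma mult_char_inverse_mult [simp]: "inverse \<chi> * \<chi> = (1 :: 'a :: {field, finite} mult_char)"
  by (simp add: mult.commute)

lemma mult_char_mult_eq_1_iff:
  "\<chi> * \<psi> = 1 \<longleftrightarrow> \<psi> = inverse (\<chi> :: 'a :: {field, finite} mult_char)"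
proof
  assume "\<chi> * \<psi> = 1"
  then have "inverse \<chi> * (\<chi> * \<psi>) = inverse \<chi>"
    by simp
  then show "\<psi> = inverse \<chi>"
    by (simp flip: mult.assoc)
qed simp

lemma sum_mult_char_delta:
  "(\<Sum>\<chi>\<in>UNIV. f \<chi> * char_delta (K * \<chi>)) = f (inverse K)"
  by (simp add: char_delta_def mult_char_mult_eq_1_iff if_distrib[of "\<lambda>x. _ * x"] cong: if_cong)

lemma sum_mult_char_delta_inverse:
  "(\<Sum>\<chi>\<in>UNIV. f \<chi> * char_delta (K * inverse \<chi>)) = f K"
proof -
  have "K * inverse \<chi> = 1 \<longleftrightarrow> \<chi> = K" for \<chi>
    by (metis mult_char_mult_eq_1_iff inverse_mult_char_inverse)
  then show ?thesis
    by (simp add: char_delta_def if_distrib[of "\<lambda>x. _ * x"] cong: if_cong)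
qed

section \<open>Cyclicity of the multiplicative group and separation of points by characters\<close>

text \<open>The field type is repackaged as a HOL-Algebra record, so that a generator can be taken
  from \<open>finite_field_mult_group_has_gen\<close>.\<close>

lemma finite_field_generator:
  "\<exists>\<gamma> :: 'a :: {field, finite}. \<forall>x. x \<noteq> 0 \<longrightarrow> (\<exists>i::nat. x = \<gamma> ^ i)"
proof -
  define R :: "'a ring" where
    "R = \<lparr>carrier = UNIV, monoid.mult = (*), one = 1, zero = 0, add = (+)\<rparr>"
  have "cring R"
  proof (intro cringI abelian_groupI comm_monoidI)
    show "\<exists>y\<in>carrier R. y \<oplus>\<^bsub>R\<^esub> x = \<zero>\<^bsub>R\<^esub>" for x
      by (rule bexI[of _ "- x"]) (simp_all add: R_def)
  qed (simp_all add: R_def algebra_simps)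
  moreover have "Units R = carrier R - {\<zero>\<^bsub>R\<^esub>}"
  proof (intro equalityI subsetI)
    show "x \<in> Units R" if "x \<in> carrier R - {\<zero>\<^bsub>R\<^esub>}" for x
      using that by (auto simp: R_def Units_def intro!: exI[of _ "inverse x"])
  qed (auto simp: R_def Units_def)
  ultimately interpret R: Ring.field R
    by (rule cring.cring_fieldI)
  have pow: "a [^]\<^bsub>R\<^esub> i = a ^ i" for a and i :: nat
    by (induction i) (simp_all add: R_def nat_pow_def)
  have "finite (carrier R)"
    by (simp add: R_def)
  from R.finite_field_mult_group_has_gen[OF this]
  obtain a where "carrier (mult_of R) = {a [^]\<^bsub>R\<^esub> i | i :: nat. i \<in> UNIV}"
    by blast
  then have "UNIV - {0} = {a ^ i | i :: nat. True}"
    unfolding pow by (simp add: R_def)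
  then show ?thesis
    by blast
qed

text \<open>A generator of order n is sent to a primitive n-th root of unity. The resulting
  character is injective on the nonzero elements.\<close>

lemma separating_mult_char:
  fixes x :: "'a :: {field, finite}"
  assumes "x \<noteq> 0" "x \<noteq> 1"
  obtains \<chi> where "char_at \<chi> x \<noteq> 1"
proof -
  define n where "n = card (UNIV - {0 :: 'a})"
  have n: "n > 0"
    unfolding n_def using assms(1) by (metis DiffI UNIV_I card_gt_0_iff empty_iff finite singletonD)
  obtain \<gamma> :: 'a where \<gamma>: "\<And>x. x \<noteq> 0 \<Longrightarrow> \<exists>i::nat. x = \<gamma> ^ i"
    using finite_field_generator by blast
  \<comment> \<open>The powers of 0 are only 0 and 1, which would leave no room for
    \<open>x\<close>.\<close>
  have \<gamma>0: "\<gamma> \<noteq> 0"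
  proof
    assume "\<gamma> = 0"
    then have "y = 1" if "y \<noteq> 0" for y :: 'a
      using \<gamma>[OF that] that by (metis power_0 power_0_left)
    with assms show False by blast
  qed
  have \<gamma>n: "\<gamma> ^ n = 1"
  proof -
    have "bij_betw ((*) \<gamma>) (UNIV - {0}) (UNIV - {0})"
      using \<gamma>0 by (intro bij_betwI[where g = "\<lambda>y. y / \<gamma>"]) auto
    then have "(\<Prod>y\<in>UNIV - {0}. y) = (\<Prod>y\<in>UNIV - {0}. \<gamma> * y)"
      by (rule prod.reindex_bij_betw[symmetric])
    also have "\<dots> = \<gamma> ^ n * (\<Prod>y\<in>UNIV - {0}. y)"
      by (simp add: n_def prod.distrib)
    finally show ?thesis
      by simp
  qed
  have pow_mod: "\<gamma> ^ i = \<gamma> ^ (i mod n)" for i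
  proof -
    have "\<gamma> ^ i = \<gamma> ^ (n * (i div n) + i mod n)"
      by simp
    also have "\<dots> = \<gamma> ^ (i mod n)"
      by (simp only: power_add power_mult \<gamma>n power_one mult_1)
    finally show ?thesis .
  qed
  \<comment> \<open>The n powers with exponent below n already cover all n nonzero elements, so by
    counting they are distinct, and exponents are determined modulo n.\<close>
  have "(\<lambda>i. \<gamma> ^ i) ` {..<n} = UNIV - {0}"
  proof (intro equalityI subsetI)
    fix y assume "y \<in> UNIV - {0 :: 'a}"
    then obtain i where "y = \<gamma> ^ i"
      using \<gamma> by blast
    then show "y \<in> (\<lambda>i. \<gamma> ^ i) ` {..<n}"
      using pow_mod[of i] n by (intro image_eqI[of _ _ "i mod n"]) auto
  qed (use \<gamma>0 in auto)
  then have inj: "inj_on (\<lambda>i. \<gamma> ^ i) {..<n}"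
    by (intro eq_card_imp_inj_on) (auto simp: n_def)
  have cong: "i mod n = j mod n" if "\<gamma> ^ i = \<gamma> ^ j" for i j
    using that inj_onD[OF inj, of "i mod n" "j mod n"] pow_mod[of i] pow_mod[of j] n by auto
  define z where "z = cis (2 * pi / of_nat n)"
  have z_pow: "z ^ i = cis (2 * pi * of_nat i / of_nat n)" for i
    by (simp add: z_def DeMoivre field_simps)
  have zn: "z ^ n = 1"
    using n by (simp add: z_pow)
  have z_mod: "z ^ i = z ^ (i mod n)" for i
  proof -
    have "z ^ i = z ^ (n * (i div n) + i mod n)"
      by simp
    also have "\<dots> = z ^ (i mod n)"
      by (simp only: power_add power_mult zn power_one mult_1)
    finally show ?thesis .
  qed
  \<comment> \<open>A discrete logarithm; the choice affects it only by multiples of n, which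
    \<open>z ^ n = 1\<close> makes invisible in \<open>f\<close>.\<close>
  define l where "l y = (SOME i. y = \<gamma> ^ i)" for y
  have l: "\<gamma> ^ l y = y" if "y \<noteq> 0" for y
    unfolding l_def using someI_ex[OF \<gamma>[OF that]] by simp
  define f where "f y = (if y = 0 then 0 else z ^ l y)" for y
  have f_pow: "f (\<gamma> ^ i) = z ^ i" for i
  proof -
    have "\<gamma> ^ l (\<gamma> ^ i) = \<gamma> ^ i"
      by (rule l) (use \<gamma>0 in simp)
    from cong[OF this] show ?thesis
      using \<gamma>0 z_mod[of i] z_mod[of "l (\<gamma> ^ i)"] by (simp add: f_def)
  qed
  have f_mult: "f (y * w) = f y * f w" for y w
  proof (cases "y = 0 \<or> w = 0")
    case False
    then obtain i j where "y = \<gamma> ^ i" "w = \<gamma> ^ j"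
      using \<gamma> by blast
    then show ?thesis
      by (simp add: f_pow flip: power_add)
  qed (auto simp: f_def)
  have f: "f \<in> {\<chi>. \<chi> 0 = 0 \<and> \<chi> 1 = 1 \<and> (\<forall>x y. \<chi> (x * y) = \<chi> x * \<chi> y)}"
    using f_pow[of 0] f_mult by (simp add: f_def)
  have "f x \<noteq> 1"
  proof
    assume "f x = 1"
    obtain i where i: "x = \<gamma> ^ i"
      using \<gamma> assms by blast
    have "z ^ (i mod n) = 1"
      using \<open>f x = 1\<close> by (simp add: i f_pow flip: z_mod)
    then have "i mod n = 0"
      using inj_onD[OF bij_betw_imp_inj_on[OF bij_betw_roots_unity[OF n]], of "i mod n" 0] n
      by (simp add: z_pow)
    then show False
      using i assms pow_mod[of i] by simp
  qed
  then show ?thesis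
    using that[of "Abs_mult_char f"] by (simp add: Abs_mult_char_inverse[OF f])
qed

section \<open>Orthogonality relations\<close>

lemma sum_char_at:
  fixes \<chi> :: "'a :: {field, finite} mult_char"
  shows "(\<Sum>x\<in>UNIV. char_at \<chi> x) = (of_nat CARD('a) - 1) * char_delta \<chi>"
proof (cases "\<chi> = 1")
  case True
  have "(\<Sum>x\<in>UNIV. char_at (1 :: 'a mult_char) x) = (\<Sum>x\<in>UNIV - {0 :: 'a}. 1)"
    by (intro sum.mono_neutral_cong_right) (auto simp: char_at_one)
  also have "\<dots> = of_nat CARD('a) - 1"
    by (simp add: card_Diff_singleton of_nat_diff Suc_leI)
  finally show ?thesis
    using True by (simp add: char_delta_def)
next
  case False
  then obtain y where y: "y \<noteq> 0" "char_at \<chi> y \<noteq> 1"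
    using mult_char_eqI[of \<chi> 1] by (auto simp: char_at_one)
  have "bij_betw ((*) y) UNIV UNIV"
    using y by (intro bij_betwI[where g = "\<lambda>x. x / y"]) auto
  then have "(\<Sum>x\<in>UNIV. char_at \<chi> x) = (\<Sum>x\<in>UNIV. char_at \<chi> (y * x))"
    by (rule sum.reindex_bij_betw[symmetric])
  also have "\<dots> = char_at \<chi> y * (\<Sum>x\<in>UNIV. char_at \<chi> x)"
    by (simp add: char_at_mult sum_distrib_left)
  finally show ?thesis
    using y False by (simp add: char_delta_def)
qed

lemma bij_mult_char_mult: "bij ((*) (\<chi> :: 'a :: {field, finite} mult_char))"
  by (rule bij_betwI[where g = "(*) (inverse \<chi>)"]) (simp_all flip: mult.assoc)

lemma sum_over_mult_chars_neq_1:
  fixes x :: "'a :: {field, finite}"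
  assumes "x \<noteq> 1"
  shows "(\<Sum>\<chi>\<in>UNIV. char_at \<chi> x) = 0"
proof (cases "x = 0")
  case False
  then obtain \<psi> where \<psi>: "char_at \<psi> x \<noteq> 1"
    using separating_mult_char assms by blast
  have "(\<Sum>\<chi>\<in>UNIV. char_at \<chi> x) = (\<Sum>\<chi>\<in>UNIV. char_at (\<psi> * \<chi>) x)"
    by (rule sum.reindex_bij_betw[OF bij_mult_char_mult, symmetric])
  also have "\<dots> = char_at \<psi> x * (\<Sum>\<chi>\<in>UNIV. char_at \<chi> x)"
    by (simp add: char_at_times sum_distrib_left)
  finally show ?thesis
    using \<psi> by simp
qed simp

text \<open>The value at 1 is the number of characters. It comes from summing over all points and
  all characters in both orders, since each order leaves a single nonzero term.\<close>

lemma sum_over_mult_chars: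
  fixes x :: "'a :: {field, finite}"
  shows "(\<Sum>\<chi>\<in>UNIV. char_at \<chi> x) = (if x = 1 then of_nat CARD('a) - 1 else 0)"
proof -
  have "(\<Sum>\<chi>\<in>UNIV. char_at \<chi> (1 :: 'a)) = (\<Sum>x\<in>UNIV. \<Sum>\<chi>\<in>UNIV. char_at \<chi> (x :: 'a))"
    by (rule sum.mono_neutral_cong_left[of _ "{1}", simplified]) (auto simp: sum_over_mult_chars_neq_1)
  also have "\<dots> = (\<Sum>\<chi>\<in>UNIV. \<Sum>x\<in>UNIV. char_at \<chi> (x :: 'a))"
    by (rule sum.swap)
  also have "\<dots> = of_nat CARD('a) - 1"
    using sum_mult_char_delta[of "\<lambda>_. of_nat CARD('a) - 1" "1 :: 'a mult_char"]
    by (simp add: sum_char_at)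
  finally show ?thesis
    using sum_over_mult_chars_neq_1[of x] by auto
qed


text \<open>This is Fourier inversion for the function u \<mapsto> \<Sum>{A(t) | t^2 = u}, whose Fourier coefficient at R
  is the sum of A R^{-2} over the field.\<close>

lemma sum_char_square_roots:
  fixes u :: "'a :: {field, finite}"
  shows "(\<Sum>R\<in>{R. R ^ 2 = A}. char_at R u) = (\<Sum>t\<in>{t. t ^ 2 = u}. char_at A t)"
proof (cases "u = 0")
  case False
  define N where "N = (of_nat CARD('a) - 1 :: complex)"
  have N: "N \<noteq> 0"
    using sum_over_mult_chars[of "1 :: 'a"] by (auto simp: N_def)
  have root: "A * inverse (R ^ 2) = 1 \<longleftrightarrow> R ^ 2 = A" for R
    by (metis mult_char_mult_eq_1_iff inverse_mult_char_inverse)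
  have coeff: "(\<Sum>t\<in>UNIV. char_at R (u / t ^ 2) * char_at A t)
      = char_at R u * N * char_delta (A * inverse (R ^ 2))" for R
  proof -
    have "char_at R (u / t ^ 2) * char_at A t = char_at R u * char_at (A * inverse (R ^ 2)) t" for t
      by (cases "t = 0") (simp_all add: char_at_mult char_at_of_inverse char_at_of_power char_at_times
          char_at_inverse char_at_power divide_inverse)
    then show ?thesis
      by (simp add: sum_char_at N_def flip: sum_distrib_left)
  qed
  have "N * (\<Sum>R\<in>{R. R ^ 2 = A}. char_at R u)
      = (\<Sum>R\<in>UNIV. char_at R u * N * char_delta (A * inverse (R ^ 2)))"
    unfolding sum_distrib_left
    by (rule sum.mono_neutral_cong_left) (auto simp: char_delta_def root)
  also have "\<dots> = (\<Sum>R\<in>UNIV. \<Sum>t\<in>UNIV. char_at R (u / t ^ 2) * char_at A t)"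
    by (simp add: coeff)
  also have "\<dots> = (\<Sum>t\<in>UNIV. \<Sum>R\<in>UNIV. char_at R (u / t ^ 2) * char_at A t)"
    by (rule sum.swap)
  also have "\<dots> = (\<Sum>t\<in>UNIV. (if u / t ^ 2 = 1 then N else 0) * char_at A t)"
    unfolding N_def by (simp add: sum_over_mult_chars flip: sum_distrib_right)
  \<comment> \<open>At t = 0 the quotient is 0 by convention, hence never 1, and 0 is not a square
    root of the nonzero \<open>u\<close> either.\<close>
  also have "\<dots> = (\<Sum>t\<in>{t. t ^ 2 = u}. N * char_at A t)"
    using False by (intro sum.mono_neutral_cong_right) (auto simp: field_simps)
  finally show ?thesis
    using N by (simp flip: sum_distrib_left)
qed simp

section \<open>Odd q: signs and square roots of characters\<close>

text \<open>If 1 + 1 = 0, adding 1 is an involution without fixed points, and its orbits split the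
  field into pairs.\<close>

lemma one_neq_minus_one_of_odd_card:
  assumes "odd CARD('a :: {field, finite})"
  shows "(1 :: 'a) \<noteq> - 1"
proof
  assume "(1 :: 'a) = - 1"
  then have "(1 :: 'a) + 1 = 0"
    by (metis add.right_inverse)
  then have two: "x + 1 + 1 = x" for x :: 'a
    by (simp add: add.assoc)
  define P where "P = range (\<lambda>x :: 'a. {x, x + 1})"
  have "2 * card P = card (\<Union>P)"
    by (rule card_partition) (auto simp: P_def two)
  moreover have "\<Union>P = UNIV"
    by (auto simp: P_def)
  ultimately have "2 * card P = CARD('a)"
    by simp
  with assms show False
    by (metis dvd_triv_left)
qed

text \<open>This is \<open>sum_char_square_roots\<close> at u = 1, whose square roots 1 and -1 are
  distinct for odd q.\<close>

lemma card_char_square_roots: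
  assumes "odd CARD('a :: {field, finite})"
  shows "of_nat (card {R. R ^ 2 = (A :: 'a mult_char)}) = 1 + char_at A (- 1)"
proof -
  have "{t. t ^ 2 = (1 :: 'a)} = {1, - 1}"
    by (auto simp: power2_eq_1_iff)
  then show ?thesis
    using sum_char_square_roots[of "1 :: 'a" A] one_neq_minus_one_of_odd_card[OF assms] by simp
qed

lemma mult_char_square_minus_one:
  assumes "R ^ 2 = A"
  shows "char_at A (- 1) = 1"
  using assms char_at_minus_one_squared[of R] by (auto simp: char_at_times power2_eq_square)

lemma mult_char_not_square_minus_one:
  fixes A :: "'a :: {field, finite} mult_char"
  assumes "odd CARD('a)" and "\<nexists>S. A = S ^ 2"
  shows "char_at A (- 1) = - 1"
proof -
  have "{R. R ^ 2 = A} = {}"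
    using assms(2) by auto
  then have "1 + char_at A (- 1) = 0"
    using card_char_square_roots[OF assms(1), of A] by simp
  then show ?thesis
    by (simp add: add_eq_0_iff)
qed

section \<open>Gauss sums\<close>

locale nontrivial_additive_char =
  fixes \<theta> :: "'a :: {field, finite} \<Rightarrow> complex" and q :: complex
  assumes additive: "additive_char \<theta>" and nontrivial: "\<exists>x. \<theta> x \<noteq> 1"
    and q_def: "q = of_nat CARD('a)"
begin

abbreviation g :: "'a mult_char \<Rightarrow> complex" where "g \<equiv> gauss_sum \<theta>"

abbreviation \<sigma> :: "'a mult_char \<Rightarrow> complex" where "\<sigma> \<chi> \<equiv> char_at \<chi> (- 1)"

definition twisted_gauss_sum :: "'a mult_char \<Rightarrow> 'a \<Rightarrow> complex" where
  "twisted_gauss_sum \<chi> c = (\<Sum>x\<in>UNIV. char_at \<chi> x * \<theta> (c * x))"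

text \<open>The usual Jacobi sum has 1 - u in place of 1 + u; the two differ by the factor \<chi>(-1).\<close>

definition jacobi_sum :: "'a mult_char \<Rightarrow> 'a mult_char \<Rightarrow> complex" where
  "jacobi_sum \<chi> \<psi> = (\<Sum>u\<in>UNIV. char_at \<chi> u * char_at \<psi> (1 + u))"

lemma q_neq_1: "q \<noteq> 1"
  using sum_over_mult_chars[of "1 :: 'a"] by (auto simp: q_def)

lemma q_neq_0 [simp]: "q \<noteq> 0"
  by (simp add: q_def)

lemma theta_0: "\<theta> 0 = 1" and theta_add: "\<theta> (x + y) = \<theta> x * \<theta> y"
  using additive by (auto simp: additive_char_def)

lemma sum_theta: "(\<Sum>x\<in>UNIV. \<theta> x) = 0"
proof -
  obtain y where y: "\<theta> y \<noteq> 1"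
    using nontrivial by blast
  have "bij_betw ((+) y) UNIV UNIV"
    by (intro bij_betwI[where g = "\<lambda>x. x - y"]) auto
  then have "(\<Sum>x\<in>UNIV. \<theta> x) = (\<Sum>x\<in>UNIV. \<theta> (y + x))"
    by (rule sum.reindex_bij_betw[symmetric])
  also have "\<dots> = \<theta> y * (\<Sum>x\<in>UNIV. \<theta> x)"
    by (simp add: theta_add sum_distrib_left)
  finally show ?thesis
    using y by simp
qed

lemma gauss_sum_one: "g 1 = - 1"
proof -
  have "(\<Sum>x\<in>UNIV. \<theta> x) = \<theta> 0 + (\<Sum>x\<in>UNIV - {0}. \<theta> x)"
    by (intro sum.remove) auto
  moreover have "g 1 = (\<Sum>x\<in>UNIV - {0}. \<theta> x)"
    unfolding gauss_sum_def by (intro sum.mono_neutral_cong_right) (auto simp: char_at_one)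
  ultimately show ?thesis
    by (simp add: sum_theta theta_0 add_eq_0_iff)
qed

text \<open>Scaling the variable settles nonzero \<open>c\<close>. One formula covers both cases
  because characters vanish at 0, which removes the first summand at c = 0.\<close>

lemma twisted_gauss_sum:
  "twisted_gauss_sum \<chi> c
    = char_at (inverse \<chi>) c * g \<chi> + (if c = 0 then (q - 1) * char_delta \<chi> else 0)"
proof (cases "c = 0")
  case True
  then show ?thesis
    by (simp add: twisted_gauss_sum_def theta_0 sum_char_at q_def)
next
  case False
  then have "bij_betw ((*) c) UNIV UNIV"
    by (intro bij_betwI[where g = "\<lambda>y. y / c"]) auto
  then have "g \<chi> = (\<Sum>x\<in>UNIV. char_at \<chi> (c * x) * \<theta> (c * x))"
    unfolding gauss_sum_def by (rule sum.reindex_bij_betw[symmetric])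
  also have "\<dots> = char_at \<chi> c * twisted_gauss_sum \<chi> c"
    by (simp add: twisted_gauss_sum_def char_at_mult sum_distrib_left mult.assoc)
  finally show ?thesis
    using False by (simp add: char_at_inverse)
qed

section \<open>Products of Gauss sums and the reflection formula\<close>

text \<open>Substituting x = u y separates the ratio u from y. The sum over y is left unevaluated,
  so that a later sum over characters can act on u by orthogonality first.\<close>

lemma gauss_sum_mult_twisted:
  "g \<alpha> * g \<gamma> = (\<Sum>u\<in>UNIV. char_at \<alpha> u * twisted_gauss_sum (\<alpha> * \<gamma>) (1 + u))"
proof -
  have inner: "(\<Sum>x\<in>UNIV. char_at \<alpha> x * \<theta> x * (char_at \<gamma> y * \<theta> y))
      = (\<Sum>u\<in>UNIV. char_at \<alpha> u * (char_at (\<alpha> * \<gamma>) y * \<theta> ((1 + u) * y)))" for y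
  proof (cases "y = 0")
    case False
    then have "bij_betw (\<lambda>u. u * y) UNIV UNIV"
      by (intro bij_betwI[where g = "\<lambda>x. x / y"]) auto
    then have "(\<Sum>x\<in>UNIV. char_at \<alpha> x * \<theta> x * (char_at \<gamma> y * \<theta> y))
        = (\<Sum>u\<in>UNIV. char_at \<alpha> (u * y) * \<theta> (u * y) * (char_at \<gamma> y * \<theta> y))"
      by (rule sum.reindex_bij_betw[symmetric])
    also have "\<dots> = (\<Sum>u\<in>UNIV. char_at \<alpha> u * (char_at (\<alpha> * \<gamma>) y * \<theta> ((1 + u) * y)))"
      by (simp add: char_at_mult char_at_times theta_add distrib_right distrib_left mult_ac)
    finally show ?thesis .
  qed simp
  have "g \<alpha> * g \<gamma> = (\<Sum>y\<in>UNIV. \<Sum>x\<in>UNIV. char_at \<alpha> x * \<theta> x * (char_at \<gamma> y * \<theta> y))"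
    unfolding gauss_sum_def sum_product by (rule sum.swap)
  also have "\<dots> = (\<Sum>u\<in>UNIV. \<Sum>y\<in>UNIV. char_at \<alpha> u * (char_at (\<alpha> * \<gamma>) y * \<theta> ((1 + u) * y)))"
    unfolding inner by (rule sum.swap)
  finally show ?thesis
    by (simp add: twisted_gauss_sum_def sum_distrib_left)
qed

text \<open>The classical relation between Gauss and Jacobi sums, valid for all characters: the
  correction is the point u = -1, where the twisted sum degenerates. The substitution v = u/(1 + u)
  turns the Jacobi sum here into the usual sum of \<alpha>(v) \<gamma>(1 - v).\<close>

lemma gauss_sum_mult:
  "g \<alpha> * g \<gamma> = g (\<alpha> * \<gamma>) * jacobi_sum \<alpha> (inverse (\<alpha> * \<gamma>)) + (q - 1) * \<sigma> \<alpha> * char_delta (\<alpha> * \<gamma>)"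
proof -
  have "(\<Sum>u\<in>UNIV. char_at \<alpha> u * (if 1 + u = 0 then (q - 1) * char_delta (\<alpha> * \<gamma>) else 0))
      = (\<Sum>u\<in>{- 1}. char_at \<alpha> u * ((q - 1) * char_delta (\<alpha> * \<gamma>)))"
    by (rule sum.mono_neutral_cong_right) (auto simp: add_eq_0_iff)
  then show ?thesis
    by (simp add: gauss_sum_mult_twisted twisted_gauss_sum jacobi_sum_def distrib_left sum.distrib
        sum_distrib_left mult_ac)
qed

lemma jacobi_sum_one: "jacobi_sum \<alpha> 1 = (q - 1) * char_delta \<alpha> - \<sigma> \<alpha>"
proof -
  have "(\<Sum>u\<in>UNIV. char_at \<alpha> u) = \<sigma> \<alpha> + (\<Sum>u\<in>UNIV - {- 1}. char_at \<alpha> u)"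
    by (intro sum.remove) auto
  moreover have "jacobi_sum \<alpha> 1 = (\<Sum>u\<in>UNIV - {- 1}. char_at \<alpha> u)"
    unfolding jacobi_sum_def
    by (intro sum.mono_neutral_cong_right) (auto simp: char_at_one add_eq_0_iff)
  ultimately show ?thesis
    by (simp add: sum_char_at q_def)
qed

text \<open>The reflection formula together with its exception: at the trivial character the product
  is 1 instead of q.\<close>

lemma gauss_sum_inverse: "g \<chi> * g (inverse \<chi>) = q * \<sigma> \<chi> - (q - 1) * char_delta \<chi>"
  unfolding gauss_sum_mult[of \<chi> "inverse \<chi>"]
  by (simp add: jacobi_sum_one gauss_sum_one char_delta_def algebra_simps)

lemma gauss_sum_inverse_nontrivial: "\<chi> \<noteq> 1 \<Longrightarrow> g \<chi> * g (inverse \<chi>) = q * \<sigma> \<chi>"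
  by (simp add: gauss_sum_inverse char_delta_def)

lemma gauss_sum_neq_0 [simp]: "g \<chi> \<noteq> 0"
proof (cases "\<chi> = 1")
  case False
  then have "g \<chi> * g (inverse \<chi>) \<noteq> 0"
    by (simp add: gauss_sum_inverse_nontrivial)
  then show ?thesis
    by auto
qed (simp add: gauss_sum_one)

text \<open>Reflection in the form that moves a Gauss sum from a denominator to a numerator; the
  delta restores the value -1 at the trivial character.\<close>

lemma inverse_gauss_sum: "1 / g \<chi> = \<sigma> \<chi> * g (inverse \<chi>) / q - (q - 1) / q * char_delta \<chi>"
proof (cases "\<chi> = 1")
  case True
  then show ?thesis
    by (simp add: gauss_sum_one char_delta_def char_at_one field_simps)
next
  case False
  have "\<sigma> \<chi> * (g \<chi> * g (inverse \<chi>)) = q"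
    using False by (simp add: gauss_sum_inverse_nontrivial char_at_minus_one_squared)
  then show ?thesis
    using False by (simp add: char_delta_def field_simps)
qed

text \<open>The parameters are paired so that \<chi> cancels in the product of each pair. After
  expanding both pairs, \<chi> occurs only through its value at z u/v, and orthogonality forces v =
  z u. The first Barnes lemma is the case z = 1, Kummer's theorem the case z = -1.\<close>

lemma sum_gauss_sums_4:
  assumes "z \<noteq> 0"
  shows "(\<Sum>\<chi>\<in>UNIV. char_at \<chi> z * (g (a * \<chi>) * g (c * inverse \<chi>)) * (g (d * inverse \<chi>) * g (b * \<chi>)))
    = (q - 1) * (\<Sum>u\<in>UNIV. char_at a u * char_at d (z * u)
        * twisted_gauss_sum (a * c) (1 + u) * twisted_gauss_sum (b * d) (1 + z * u))"
proof -
  have ac: "a * \<chi> * (c * inverse \<chi>) = a * c" and bd: "d * inverse \<chi> * (b * \<chi>) = b * d" for \<chi>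
    by (rule mult_char_eqI; simp add: char_at_times char_at_inverse field_simps)+
  define G where "G u v = char_at a u * char_at d v
        * twisted_gauss_sum (a * c) (1 + u) * twisted_gauss_sum (b * d) (1 + v)" for u v
  have "(\<Sum>\<chi>\<in>UNIV. char_at \<chi> z * (g (a * \<chi>) * g (c * inverse \<chi>)) * (g (d * inverse \<chi>) * g (b * \<chi>)))
      = (\<Sum>\<chi>\<in>UNIV. \<Sum>u\<in>UNIV. \<Sum>v\<in>UNIV. char_at \<chi> (z * u / v) * G u v)"
  proof (rule sum.cong[OF refl])
    fix \<chi>
    have "char_at \<chi> z * (g (a * \<chi>) * g (c * inverse \<chi>)) * (g (d * inverse \<chi>) * g (b * \<chi>))
        = (\<Sum>u\<in>UNIV. \<Sum>v\<in>UNIV. char_at \<chi> z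
            * (char_at (a * \<chi>) u * twisted_gauss_sum (a * c) (1 + u)
              * (char_at (d * inverse \<chi>) v * twisted_gauss_sum (b * d) (1 + v))))"
      unfolding gauss_sum_mult_twisted ac bd
      by (simp only: mult.assoc[of "char_at \<chi> z"], subst sum_product, simp only: sum_distrib_left)
    also have "\<dots> = (\<Sum>u\<in>UNIV. \<Sum>v\<in>UNIV. char_at \<chi> (z * u / v) * G u v)"
      by (simp add: G_def char_at_times char_at_inverse char_at_mult char_at_of_inverse
          divide_inverse mult_ac)
    finally show "char_at \<chi> z * (g (a * \<chi>) * g (c * inverse \<chi>)) * (g (d * inverse \<chi>) * g (b * \<chi>))
        = (\<Sum>u\<in>UNIV. \<Sum>v\<in>UNIV. char_at \<chi> (z * u / v) * G u v)" .
  qed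
  also have "\<dots> = (\<Sum>u\<in>UNIV. \<Sum>\<chi>\<in>UNIV. \<Sum>v\<in>UNIV. char_at \<chi> (z * u / v) * G u v)"
    by (rule sum.swap)
  also have "\<dots> = (\<Sum>u\<in>UNIV. \<Sum>v\<in>UNIV. \<Sum>\<chi>\<in>UNIV. char_at \<chi> (z * u / v) * G u v)"
    by (intro sum.cong refl sum.swap)
  also have "\<dots> = (\<Sum>u\<in>UNIV. \<Sum>v\<in>UNIV. (if z * u / v = 1 then q - 1 else 0) * G u v)"
    unfolding q_def by (simp add: sum_over_mult_chars flip: sum_distrib_right)
  also have "\<dots> = (\<Sum>u\<in>UNIV. (q - 1) * G u (z * u))"
  proof (intro sum.cong refl)
    fix u
    \<comment> \<open>If z u = 0, the condition fails even at v = z u because division by 0 gives 0;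
      this is harmless, as \<open>G\<close> vanishes there.\<close>
    have "(\<Sum>v\<in>UNIV. (if z * u / v = 1 then q - 1 else 0) * G u v)
        = (\<Sum>v\<in>{z * u}. (q - 1) * G u v)"
      by (rule sum.mono_neutral_cong_right) (auto simp: field_simps G_def)
    then show "(\<Sum>v\<in>UNIV. (if z * u / v = 1 then q - 1 else 0) * G u v) = (q - 1) * G u (z * u)"
      by simp
  qed
  finally show ?thesis
    by (simp add: G_def sum_distrib_left)
qed

section \<open>Summation formulas\<close>

text \<open>With z = 1 both twisted sums are taken at 1 + u. Away from u = -1 their product is a
  constant times a single character of 1 + u, so one Jacobi sum remains.\<close>

lemma sum_barnes_first:
  "(\<Sum>\<chi>\<in>UNIV. g (a * \<chi>) * g (b * \<chi>) * g (c * inverse \<chi>) * g (d * inverse \<chi>))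
    = (q - 1) * (g (a * c) * g (a * d) * g (b * c) * g (b * d) / g (a * b * c * d)
        + q * (q - 1) * \<sigma> (a * b) * char_delta (a * b * c * d))"
proof -
  define M M' P Q H where "M = a * c" "M' = b * d" "P = a * d" "Q = b * c" "H = a * b * c * d"
  note defs = this
  have PQ: "P * Q = H" and MM': "M * M' = H"
    by (simp_all add: defs mult_ac)
  have "(\<Sum>\<chi>\<in>UNIV. g (a * \<chi>) * g (b * \<chi>) * g (c * inverse \<chi>) * g (d * inverse \<chi>))
      = (q - 1) * (\<Sum>u\<in>UNIV. char_at P u * (twisted_gauss_sum M (1 + u) * twisted_gauss_sum M' (1 + u)))"
    using sum_gauss_sums_4[of 1 a c d b] by (simp add: defs char_at_times mult_ac)
  also have "(\<Sum>u\<in>UNIV. char_at P u * (twisted_gauss_sum M (1 + u) * twisted_gauss_sum M' (1 + u)))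
      = (\<Sum>u\<in>UNIV. g M * g M' * (char_at P u * char_at (inverse H) (1 + u))
          + (if u = - 1 then \<sigma> P * (q - 1)\<^sup>2 * char_delta M * char_delta M' else 0))"
    by (rule sum.cong)
      (auto simp: twisted_gauss_sum power2_eq_square char_at_times inverse_mult_char_mult
        add_eq_0_iff simp flip: MM')
  also have "\<dots> = g M * g M' * jacobi_sum P (inverse H)
      + \<sigma> P * (q - 1)\<^sup>2 * char_delta M * char_delta M'"
    by (simp add: sum.distrib jacobi_sum_def sum_distrib_left)
  also have "\<dots> = g M * g P * g Q * g M' / g H + q * (q - 1) * \<sigma> (a * b) * char_delta H"
  proof (cases "H = 1")
    \<comment> \<open>\<open>M\<close> and \<open>M'\<close> cannot both be trivial, so the
      correction at u = -1 vanishes.\<close>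
    case False
    then have "char_delta M * char_delta M' = 0"
      using MM' by (auto simp: char_delta_def)
    moreover have "jacobi_sum P (inverse H) = g P * g Q / g H"
      using gauss_sum_mult[of P Q] False by (simp add: PQ char_delta_def)
    moreover have "char_delta H = 0"
      using False by (simp add: char_delta_def)
    ultimately show ?thesis
      by auto
  next
    \<comment> \<open>Now the Jacobi sum is elementary and each of the two pairs is a character with
      its inverse, so both sides are polynomials in q, signs and deltas.\<close>
    case True
    then have M': "M' = inverse M" and Q: "Q = inverse P"
      using PQ MM' by (simp_all add: mult_char_mult_eq_1_iff)
    have "\<sigma> a * \<sigma> b * \<sigma> c * \<sigma> d = 1"
      using arg_cong[OF True, of \<sigma>] by (simp add: defs char_at_times char_at_one)
    moreover have "\<sigma> a * \<sigma> b = (\<sigma> a * \<sigma> b * \<sigma> c * \<sigma> d) * (\<sigma> c * \<sigma> d)"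
      using char_at_minus_one_squared[of c] char_at_minus_one_squared[of d] by (simp add: mult_ac)
    ultimately have "\<sigma> a * \<sigma> b = \<sigma> c * \<sigma> d"
      by simp
    then have \<sigma>: "\<sigma> (a * b) = \<sigma> P * \<sigma> M"
      using char_at_minus_one_squared[of a] by (simp add: defs char_at_times mult_ac)
    have gM: "g M * g M' = q * \<sigma> M - (q - 1) * char_delta M"
      and gP: "g P * g Q = q * \<sigma> P - (q - 1) * char_delta P"
      unfolding M' Q by (rule gauss_sum_inverse)+
    have "g M * g P * g Q * g M' / g H = - (g M * g M') * (g P * g Q)"
      by (simp add: True gauss_sum_one)
    moreover have "char_delta M' = char_delta M"
      unfolding M' char_delta_def by (metis inverse_mult_char_inverse inverse_mult_char_one)
    ultimately show ?thesis
      unfolding gM gP \<sigma> using True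
      by (auto simp: jacobi_sum_one char_delta_def char_at_one power2_eq_square algebra_simps)
  qed
  finally show ?thesis
    by (simp add: defs)
qed

section \<open>Kummer's theorem\<close>

text \<open>With z = -1 the twisted sums, both for B, sit at 1 + u and 1 - u, and their product
  depends on u^2 only. Grouping by v = u^2 leaves the sum of A over the square roots of v, which
  \<open>sum_char_square_roots\<close> turns into the sum over R with R^2 = A.\<close>

lemma sum_kummer:
  assumes "odd CARD('a)"
  shows "(\<Sum>\<chi>\<in>UNIV. \<sigma> \<chi> * (g (A * \<chi>) * g (inverse \<chi>)) * (g (B * \<chi>) * g (B * inverse A * inverse \<chi>)))
    = (q - 1) * (\<Sum>R\<in>{R. R ^ 2 = A}. \<sigma> R * g R * g B * g (inverse R * B))"
proof -
  have neq: "(1 :: 'a) \<noteq> - 1"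
    by (rule one_neq_minus_one_of_odd_card) fact
  then have neq2: "(2 :: 'a) \<noteq> 0"
    by (metis add.inverse_unique one_add_one)
  have 1: "A * (B * inverse A) = B"
    by (rule mult_char_eqI) (simp add: char_at_times char_at_inverse)
  have "(\<Sum>\<chi>\<in>UNIV. \<sigma> \<chi> * (g (A * \<chi>) * g (inverse \<chi>)) * (g (B * \<chi>) * g (B * inverse A * inverse \<chi>)))
      = (\<Sum>\<chi>\<in>UNIV. char_at \<chi> (- 1) * (g (A * \<chi>) * g (B * inverse A * inverse \<chi>)) * (g (1 * inverse \<chi>) * g (B * \<chi>)))"
    by (simp add: mult_ac)
  also have "\<dots> = (q - 1) * (\<Sum>u\<in>UNIV. char_at A u * char_at 1 (- 1 * u)
        * twisted_gauss_sum (A * (B * inverse A)) (1 + u) * twisted_gauss_sum (B * 1) (1 + - 1 * u))"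
    by (rule sum_gauss_sums_4) simp
  also have "\<dots> = (q - 1) * (\<Sum>u\<in>UNIV. char_at A u * (twisted_gauss_sum B (1 + u) * twisted_gauss_sum B (1 - u)))"
    unfolding 1 by (intro arg_cong[of _ _ "(*) (q - 1)"] sum.cong) (auto simp: char_at_one)
  \<comment> \<open>At u = 1 and u = -1 one twisted sum is degenerate and contributes only for
    trivial B; the other is then g(1) = -1, whence the minus sign.\<close>
  also have "(\<Sum>u\<in>UNIV. char_at A u * (twisted_gauss_sum B (1 + u) * twisted_gauss_sum B (1 - u)))
      = (\<Sum>u\<in>UNIV. g B * g B * (char_at A u * char_at (inverse B) (1 - u ^ 2))
          - ((if u = - 1 then (q - 1) * char_delta B * \<sigma> A else 0)
            + (if u = 1 then (q - 1) * char_delta B else 0)))"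
  proof (intro sum.cong refl)
    fix u :: 'a
    consider "u = 1" | "u = - 1" | "u \<noteq> 1" "u \<noteq> - 1"
      by blast
    then show "char_at A u * (twisted_gauss_sum B (1 + u) * twisted_gauss_sum B (1 - u))
      = g B * g B * (char_at A u * char_at (inverse B) (1 - u ^ 2))
          - ((if u = - 1 then (q - 1) * char_delta B * \<sigma> A else 0)
            + (if u = 1 then (q - 1) * char_delta B else 0))"
    proof cases
      case 1
      then show ?thesis
        using neq neq2 by (auto simp: twisted_gauss_sum char_delta_def gauss_sum_one char_at_one)
    next
      case 2
      then show ?thesis
        using neq neq2 by (auto simp: twisted_gauss_sum char_delta_def gauss_sum_one char_at_one algebra_simps)
    next
      case 3
      moreover have "1 - u ^ 2 = (1 + u) * (1 - u)"
        by (simp add: algebra_simps power2_eq_square)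
      moreover have "1 + u \<noteq> 0"
        using 3 by (simp add: add_eq_0_iff)
      ultimately show ?thesis
        by (simp add: twisted_gauss_sum char_at_mult)
    qed
  qed
  also have "\<dots> = g B * g B * (\<Sum>u\<in>UNIV. char_at A u * char_at (inverse B) (1 - u ^ 2))
      - (q - 1) * char_delta B * (1 + \<sigma> A)"
    by (simp add: sum.distrib sum_subtractf sum_distrib_left algebra_simps)
  also have "(\<Sum>u\<in>UNIV. char_at A u * char_at (inverse B) (1 - u ^ 2))
      = (\<Sum>R\<in>{R. R ^ 2 = A}. \<sigma> R * jacobi_sum R (inverse B))"
  proof -
    have "(\<Sum>u\<in>UNIV. char_at A u * char_at (inverse B) (1 - u ^ 2))
        = (\<Sum>v\<in>UNIV. \<Sum>u\<in>{u\<in>UNIV. u ^ 2 = v}. char_at A u * char_at (inverse B) (1 - u ^ 2))"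
      by (rule sum.group[symmetric]) auto
    also have "\<dots> = (\<Sum>v\<in>UNIV. (\<Sum>u\<in>{u. u ^ 2 = v}. char_at A u) * char_at (inverse B) (1 - v))"
      by (simp add: sum_distrib_right)
    also have "\<dots> = (\<Sum>v\<in>UNIV. \<Sum>R\<in>{R. R ^ 2 = A}. char_at R v * char_at (inverse B) (1 - v))"
      by (simp add: sum_distrib_right flip: sum_char_square_roots)
    also have "\<dots> = (\<Sum>R\<in>{R. R ^ 2 = A}. \<Sum>v\<in>UNIV. char_at R v * char_at (inverse B) (1 - v))"
      by (rule sum.swap)
    also have "\<dots> = (\<Sum>R\<in>{R. R ^ 2 = A}. \<sigma> R * jacobi_sum R (inverse B))"
    proof (intro sum.cong refl)
      fix R
      have "(\<Sum>v\<in>UNIV. char_at R v * char_at (inverse B) (1 - v))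
          = (\<Sum>v\<in>UNIV. char_at R (- v) * char_at (inverse B) (1 - (- v)))"
        by (rule sum.reindex_bij_betw[symmetric]) (intro bij_betwI[where g = uminus], auto)
      then show "(\<Sum>v\<in>UNIV. char_at R v * char_at (inverse B) (1 - v)) = \<sigma> R * jacobi_sum R (inverse B)"
        by (simp add: jacobi_sum_def sum_distrib_left flip: mult.assoc char_at_minus)
    qed
    finally show ?thesis .
  qed
  \<comment> \<open>Passing from Jacobi to Gauss sums costs one delta term per square root R. There
    are 1 + A(-1) of them, so these terms cancel the corrections at u = 1 and u = -1.\<close>
  also have "g B * g B * (\<Sum>R\<in>{R. R ^ 2 = A}. \<sigma> R * jacobi_sum R (inverse B))
      = (\<Sum>R\<in>{R. R ^ 2 = A}. \<sigma> R * g R * g B * g (inverse R * B) + (q - 1) * char_delta B)"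
    unfolding sum_distrib_left
  proof (intro sum.cong refl)
    fix R
    have "R * (inverse R * B) = B"
      by (rule mult_char_eqI) (simp add: char_at_times char_at_inverse)
    then have jacobi: "g R * g (inverse R * B) = g B * jacobi_sum R (inverse B) + (q - 1) * \<sigma> R * char_delta B"
      using gauss_sum_mult[of R "inverse R * B"] by simp
    have delta: "g B * char_delta B = - char_delta B"
      by (simp add: char_delta_def gauss_sum_one)
    have "\<sigma> R * g R * g B * g (inverse R * B) = \<sigma> R * g B * (g R * g (inverse R * B))"
      by (simp only: mult_ac)
    also have "\<dots> = g B * g B * (\<sigma> R * jacobi_sum R (inverse B)) + (q - 1) * (\<sigma> R * \<sigma> R) * (g B * char_delta B)"
      unfolding jacobi by (simp only: distrib_left mult_ac)
    finally show "g B * g B * (\<sigma> R * jacobi_sum R (inverse B))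
        = \<sigma> R * g R * g B * g (inverse R * B) + (q - 1) * char_delta B"
      unfolding delta char_at_minus_one_squared by simp
  qed
  also have "\<dots> = (\<Sum>R\<in>{R. R ^ 2 = A}. \<sigma> R * g R * g B * g (inverse R * B))
      + (q - 1) * char_delta B * (1 + \<sigma> A)"
    by (simp add: sum.distrib card_char_square_roots[OF assms] mult_ac)
  finally show ?thesis
    by simp
qed

section \<open>Dixon's theorem\<close>

text \<open>Orthogonality leaves only u = -1, where the twisted sum of a nontrivial character is 0.
  This disposes of the delta term in \<open>sum_dixon\<close>, which is constant in \<chi>.\<close>

lemma sum_gauss_sums_2:
  assumes "A \<noteq> 1"
  shows "(\<Sum>\<chi>\<in>UNIV. \<sigma> \<chi> * (g (A * \<chi>) * g (inverse \<chi>))) = 0"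
proof -
  have A: "A * \<chi> * inverse \<chi> = A" for \<chi>
    by (rule mult_char_eqI) (simp add: char_at_times char_at_inverse)
  have \<sigma>: "\<sigma> \<chi> * (char_at (A * \<chi>) u * t) = char_at \<chi> (- u) * (char_at A u * t)" for \<chi> u t
    by (subst char_at_minus[of \<chi> u]) (simp add: char_at_times mult_ac)
  have "(\<Sum>\<chi>\<in>UNIV. \<sigma> \<chi> * (g (A * \<chi>) * g (inverse \<chi>)))
      = (\<Sum>\<chi>\<in>UNIV. \<Sum>u\<in>UNIV. char_at \<chi> (- u) * (char_at A u * twisted_gauss_sum A (1 + u)))"
    unfolding gauss_sum_mult_twisted A sum_distrib_left \<sigma> ..
  also have "\<dots> = (\<Sum>u\<in>UNIV. \<Sum>\<chi>\<in>UNIV. char_at \<chi> (- u) * (char_at A u * twisted_gauss_sum A (1 + u)))"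
    by (rule sum.swap)
  also have "\<dots> = (\<Sum>u\<in>UNIV. (if - u = 1 then of_nat CARD('a) - 1 else 0) * (char_at A u * twisted_gauss_sum A (1 + u)))"
    by (simp only: sum_over_mult_chars flip: sum_distrib_right)
  also have "\<dots> = 0"
    using assms
    by (intro sum.neutral) (auto simp: twisted_gauss_sum char_delta_def neg_eq_iff_add_eq_0 add.commute)
  finally show ?thesis .
qed

text \<open>The factors for B and C are replaced by a sum over \<psi> of one well-poised pair with
  parameter 1/\<psi>. Kummer's theorem then does the sum over \<chi>, and the first Barnes lemma the
  sum over \<psi>. All conditions concern A and B, so C may later run through all
  characters.\<close>

lemma sum_dixon:
  assumes "odd CARD('a)" and "A \<noteq> 1" and "B \<noteq> 1" and "B ^ 2 \<noteq> A"
  shows "(\<Sum>\<chi>\<in>UNIV. \<sigma> \<chi> * (g (A * \<chi>) * g (inverse \<chi>)) * (g (B * \<chi>) * g (B * inverse A * inverse \<chi>))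
        * (g (C * \<chi>) * g (C * inverse A * inverse \<chi>)))
    = (q - 1) * g (B * C * inverse A) * (\<Sum>R\<in>{R. R ^ 2 = A}.
        \<sigma> (B * C) * g R * g B * g (B * inverse R) * g C * g (C * inverse R) * g (R * inverse B * inverse C) / q)"
    (is "?lhs = _ * _ * (\<Sum>R\<in>_. ?t R)")
proof -
  define H where "H = B * C * inverse A"
  define K where "K \<chi> = \<sigma> \<chi> * (g (A * \<chi>) * g (inverse \<chi>))" for \<chi>
  define L where "L \<chi> \<psi> = g (inverse \<psi> * \<chi>) * g (inverse \<psi> * inverse A * inverse \<chi>)" for \<chi> \<psi>
  \<comment> \<open>The first Barnes lemma for B, C, \<chi> and 1/(A \<chi>), read backwards: the
    product of these four is free of \<chi>, so g(H) and the delta term are constants.\<close>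
  have expand: "(q - 1) * ((g (B * \<chi>) * g (B * inverse A * inverse \<chi>)) * (g (C * \<chi>) * g (C * inverse A * inverse \<chi>)))
      = g H * (\<Sum>\<psi>\<in>UNIV. (g (B * \<psi>) * g (C * \<psi>)) * L \<chi> \<psi>)
        - g H * (q - 1)\<^sup>2 * q * \<sigma> (B * C) * char_delta H" for \<chi>
  proof -
    have H: "B * C * \<chi> * (inverse A * inverse \<chi>) = H"
      by (rule mult_char_eqI) (simp add: H_def char_at_times char_at_inverse)
    have "(\<Sum>\<psi>\<in>UNIV. (g (B * \<psi>) * g (C * \<psi>)) * L \<chi> \<psi>)
       = (q - 1) * (g (B * \<chi>) * g (B * inverse A * inverse \<chi>) * g (C * \<chi>) * g (C * inverse A * inverse \<chi>) / g H
           + q * (q - 1) * \<sigma> (B * C) * char_delta H)"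
      using sum_barnes_first[of B C \<chi> "inverse A * inverse \<chi>"] unfolding H
      by (simp add: L_def mult_ac)
    then show ?thesis
      by (simp add: field_simps power2_eq_square)
  qed
  have kummer: "(\<Sum>\<chi>\<in>UNIV. K \<chi> * L \<chi> \<psi>)
      = (q - 1) * (\<Sum>R\<in>{R. R ^ 2 = A}. \<sigma> R * g R * (g (inverse \<psi>) * g (inverse R * inverse \<psi>)))" for \<psi>
    using sum_kummer[OF assms(1), of A "inverse \<psi>"] by (simp add: K_def L_def mult.assoc)
  have "(q - 1) * ?lhs = (\<Sum>\<chi>\<in>UNIV. K \<chi> * ((q - 1) * ((g (B * \<chi>) * g (B * inverse A * inverse \<chi>))
        * (g (C * \<chi>) * g (C * inverse A * inverse \<chi>)))))"
    by (simp add: K_def sum_distrib_left mult_ac)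
  also have "\<dots> = (\<Sum>\<chi>\<in>UNIV. g H * (\<Sum>\<psi>\<in>UNIV. (g (B * \<psi>) * g (C * \<psi>)) * (K \<chi> * L \<chi> \<psi>))
      - g H * (q - 1)\<^sup>2 * q * \<sigma> (B * C) * char_delta H * K \<chi>)"
    unfolding expand by (simp add: right_diff_distrib sum_distrib_left mult_ac)
  also have "\<dots> = g H * (\<Sum>\<chi>\<in>UNIV. \<Sum>\<psi>\<in>UNIV. (g (B * \<psi>) * g (C * \<psi>)) * (K \<chi> * L \<chi> \<psi>))
      - g H * (q - 1)\<^sup>2 * q * \<sigma> (B * C) * char_delta H * (\<Sum>\<chi>\<in>UNIV. K \<chi>)"
    by (simp only: sum_subtractf sum_distrib_left)
  also have "(\<Sum>\<chi>\<in>UNIV. K \<chi>) = 0"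
    unfolding K_def by (rule sum_gauss_sums_2) fact
  also have "(\<Sum>\<chi>\<in>UNIV. \<Sum>\<psi>\<in>UNIV. (g (B * \<psi>) * g (C * \<psi>)) * (K \<chi> * L \<chi> \<psi>))
      = (\<Sum>\<psi>\<in>UNIV. (g (B * \<psi>) * g (C * \<psi>)) * (\<Sum>\<chi>\<in>UNIV. K \<chi> * L \<chi> \<psi>))"
    unfolding sum_distrib_left by (rule sum.swap)
  also have "\<dots> = (\<Sum>\<psi>\<in>UNIV. \<Sum>R\<in>{R. R ^ 2 = A}. (q - 1) * (\<sigma> R * g R
      * (g (B * \<psi>) * g (C * \<psi>) * g (1 * inverse \<psi>) * g (inverse R * inverse \<psi>))))"
    unfolding kummer by (simp add: sum_distrib_left mult_ac)
  also have "\<dots> = (\<Sum>R\<in>{R. R ^ 2 = A}. \<Sum>\<psi>\<in>UNIV. (q - 1) * (\<sigma> R * g R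
      * (g (B * \<psi>) * g (C * \<psi>) * g (1 * inverse \<psi>) * g (inverse R * inverse \<psi>))))"
    by (rule sum.swap)
  also have "\<dots> = (\<Sum>R\<in>{R. R ^ 2 = A}. (q - 1) * ((q - 1) * ?t R))"
  proof (intro sum.cong refl)
    fix R assume "R \<in> {R. R ^ 2 = A}"
    then have "B \<noteq> R"
      using assms(4) by auto
    define \<eta> where "\<eta> = B * C * inverse R"
    have eta: "B * C * 1 * inverse R = \<eta>" "inverse \<eta> = R * inverse B * inverse C"
      by (rule mult_char_eqI; simp add: \<eta>_def char_at_times char_at_inverse)+
    \<comment> \<open>Reflection moves g(\<eta>) to the numerator. It fails at \<eta> = 1, where the
      delta term makes up the difference: there C = R/B, and the four factors form two reflected
      pairs, at B and at B/R, both nontrivial.\<close>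
    have "g (B * 1) * g (B * inverse R) * g (C * 1) * g (C * inverse R) / g \<eta>
          + q * (q - 1) * \<sigma> (B * C) * char_delta \<eta>
        = \<sigma> (B * C) * \<sigma> R * g B * g (B * inverse R) * g C * g (C * inverse R) * g (inverse \<eta>) / q"
    proof (cases "\<eta> = 1")
      case False
      then have "1 / g \<eta> = \<sigma> \<eta> * g (inverse \<eta>) / q" "char_delta \<eta> = 0"
        by (simp_all add: inverse_gauss_sum char_delta_def)
      then show ?thesis
        by (simp add: divide_inverse \<eta>_def char_at_times char_at_inverse inverse_char_at_minus_one mult_ac)
    next
      case True
      have C: "C = inverse (B * inverse R)"
      proof (rule mult_char_mult_eq_1_iff[THEN iffD1])
        show "B * inverse R * C = 1"
          using True by (simp add: \<eta>_def mult_ac)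
      qed
      have CR: "C * inverse R = inverse B"
        unfolding C by (rule mult_char_eqI) (simp add: char_at_times char_at_inverse)
      have gB: "g B * g (inverse B) = q * \<sigma> B"
        using assms(3) by (rule gauss_sum_inverse_nontrivial)
      have gC: "g (B * inverse R) * g C = q * \<sigma> (B * inverse R)"
        unfolding C
      proof (rule gauss_sum_inverse_nontrivial, rule notI)
        assume "B * inverse R = 1"
        then have "inverse R = inverse B"
          by (simp add: mult_char_mult_eq_1_iff)
        with \<open>B \<noteq> R\<close> show False
          by (metis inverse_mult_char_inverse)
      qed
      have \<sigma>: "\<sigma> B * \<sigma> (B * inverse R) = \<sigma> R" "\<sigma> (B * C) = \<sigma> R"
        unfolding C using char_at_minus_one_squared[of B] char_at_minus_one_squared[of R]
        by (simp_all add: char_at_times char_at_inverse inverse_char_at_minus_one mult_ac)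
      have "g B * g (B * inverse R) * g C * g (C * inverse R)
          = (g B * g (inverse B)) * (g (B * inverse R) * g C)"
        unfolding CR by (simp only: mult_ac)
      also have "\<dots> = q * q * (\<sigma> B * \<sigma> (B * inverse R))"
        unfolding gB gC by (simp only: mult_ac)
      finally have prod: "g B * g (B * inverse R) * g C * g (C * inverse R) = q * q * \<sigma> R"
        unfolding \<sigma> .
      have "\<sigma> (B * C) * \<sigma> R * g B * g (B * inverse R) * g C * g (C * inverse R) * g (inverse \<eta>) / q
          = - (g B * g (B * inverse R) * g C * g (C * inverse R)) / q"
        unfolding \<sigma> True using char_at_minus_one_squared[of R] by (simp add: gauss_sum_one)
      also have "\<dots> = - (q * \<sigma> R)"
        by (simp only: prod) simp
      finally have rhs: "\<sigma> (B * C) * \<sigma> R * g B * g (B * inverse R) * g C * g (C * inverse R) * g (inverse \<eta>) / q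
          = - (q * \<sigma> R)" .
      show ?thesis
        unfolding rhs unfolding mult_1_right prod \<sigma>(2) True
        by (simp add: gauss_sum_one char_delta_def algebra_simps)
    qed
    then have "(\<Sum>\<psi>\<in>UNIV. g (B * \<psi>) * g (C * \<psi>) * g (1 * inverse \<psi>) * g (inverse R * inverse \<psi>))
        = (q - 1) * (\<sigma> (B * C) * \<sigma> R * g B * g (B * inverse R) * g C * g (C * inverse R) * g (inverse \<eta>) / q)"
      using sum_barnes_first[of B C 1 "inverse R"] unfolding eta(1) by simp
    then show "(\<Sum>\<psi>\<in>UNIV. (q - 1) * (\<sigma> R * g R
          * (g (B * \<psi>) * g (C * \<psi>) * g (1 * inverse \<psi>) * g (inverse R * inverse \<psi>))))
        = (q - 1) * ((q - 1) * ?t R)"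
      unfolding eta(2) using char_at_minus_one_squared[of R]
      by (simp flip: sum_distrib_left)
  qed
  also have "g H * (\<Sum>R\<in>{R. R ^ 2 = A}. (q - 1) * ((q - 1) * ?t R))
        - g H * (q - 1)\<^sup>2 * q * \<sigma> (B * C) * char_delta H * 0
      = (q - 1) * ((q - 1) * g H * (\<Sum>R\<in>{R. R ^ 2 = A}. ?t R))"
    unfolding sum_distrib_left[symmetric] by (simp add: mult_ac)
  finally show ?thesis
    using q_neq_1 by (simp add: H_def)
qed

section \<open>Second Barnes lemma\<close>

text \<open>The double sum of \<open>T\<close> is linked by g(t/s). Summing over s first gives a
  denominator g(H t), which reflection turns into the sixth factor of the sum; summing over t first
  leaves another sum of the first Barnes type.\<close>

lemma sum_barnes_second:
  fixes C D E e f :: "'a mult_char"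
  defines "H \<equiv> C * D * E * e * f"
  assumes "C * D * e * f \<noteq> 1" and "C * E * e * f \<noteq> 1"
  shows "g (C * D * e * f) * g (C * E * e * f) * \<sigma> H * (\<Sum>\<psi>\<in>UNIV. \<sigma> \<psi> * (g (C * \<psi>) * g (D * \<psi>) * g (E * \<psi>)
        * g (e * inverse \<psi>) * g (f * inverse \<psi>) * g (inverse H * inverse \<psi>)))
    = q * (q - 1) * (g (C * e) * g (C * f)
          * (g (D * e) * g (D * f) * g (E * e) * g (E * f) / g (D * E * e * f)
            + q * (q - 1) * \<sigma> (D * E) * char_delta (D * E * e * f))
        - q * \<sigma> (e * f) * g (C * D * e * f) * g (C * E * e * f))"
    (is "_ * _ * _ * ?W = _ * _ * (_ * _ * ?B - _)")
proof -
  \<comment> \<open>Chosen so that g(c/s) cancels the denominator that the sum over t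
    produces.\<close>
  define c where "c = C * e * f"
  define X where "X = g (C * inverse H) * g (e * H) * g (f * H)"
  define T where "T s t = g (D * s) * g (E * s) * g (c * inverse s) * g (t * inverse s)
      * (g (C * t) * g (e * inverse t) * g (f * inverse t))" for s t
  have Dc: "C * D * e * f = D * c" and Ec: "C * E * e * f = E * c"
    by (simp_all add: c_def mult_ac)
  have DH: "D * inverse H = inverse (E * c)" and EH: "E * inverse H = inverse (D * c)"
    by (rule mult_char_eqI; simp add: c_def H_def char_at_times char_at_inverse field_simps)+
  have gDc: "g (D * c) * g (E * inverse H) = q * \<sigma> (D * c)"
    and gEc: "g (E * c) * g (D * inverse H) = q * \<sigma> (E * c)"
    using assms(2,3) unfolding Dc Ec DH EH by (simp_all add: gauss_sum_inverse_nontrivial)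
  have \<sigma>: "\<sigma> (D * c) * \<sigma> (E * c) = \<sigma> (D * E)"
    using char_at_minus_one_squared[of c] by (simp add: char_at_times mult_ac)

  have "(\<Sum>s\<in>UNIV. \<Sum>t\<in>UNIV. T s t) = (\<Sum>t\<in>UNIV. \<Sum>s\<in>UNIV. T s t)"
    by (rule sum.swap)
  also have "\<dots> = (\<Sum>t\<in>UNIV. (q - 1) * (g (D * c) * g (E * c))
        * (g (C * t) * g (D * t) * g (E * t) * g (e * inverse t) * g (f * inverse t) * (1 / g (H * t)))
      + (q - 1) * q * (q - 1) * \<sigma> (D * E)
        * ((g (C * t) * g (e * inverse t) * g (f * inverse t)) * char_delta (H * t)))"
  proof (intro sum.cong refl)
    fix t
    have H: "D * E * c * t = H * t"
      by (simp add: c_def H_def mult_ac)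
    show "(\<Sum>s\<in>UNIV. T s t) = (q - 1) * (g (D * c) * g (E * c))
        * (g (C * t) * g (D * t) * g (E * t) * g (e * inverse t) * g (f * inverse t) * (1 / g (H * t)))
      + (q - 1) * q * (q - 1) * \<sigma> (D * E)
        * ((g (C * t) * g (e * inverse t) * g (f * inverse t)) * char_delta (H * t))"
      unfolding T_def sum_distrib_right[symmetric] sum_barnes_first H by (simp add: algebra_simps)
  qed
  also have "\<dots> = (q - 1) * (g (D * c) * g (E * c))
        * (\<Sum>t\<in>UNIV. g (C * t) * g (D * t) * g (E * t) * g (e * inverse t) * g (f * inverse t) * (1 / g (H * t)))
      + (q - 1) * q * (q - 1) * \<sigma> (D * E) * X"
    unfolding sum.distrib sum_distrib_left[symmetric] sum_mult_char_delta by (simp add: X_def)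
  also have "(\<Sum>t\<in>UNIV. g (C * t) * g (D * t) * g (E * t) * g (e * inverse t) * g (f * inverse t) * (1 / g (H * t)))
      = (\<Sum>t\<in>UNIV. \<sigma> H / q * (\<sigma> t * (g (C * t) * g (D * t) * g (E * t)
          * g (e * inverse t) * g (f * inverse t) * g (inverse H * inverse t)))
        - (q - 1) / q * ((g (C * t) * g (D * t) * g (E * t) * g (e * inverse t) * g (f * inverse t))
          * char_delta (H * t)))"
    by (simp only: inverse_gauss_sum) (simp add: char_at_times inverse_mult_char_mult algebra_simps)
  also have "\<dots> = \<sigma> H / q * ?W - (q - 1) / q * (X * g (D * inverse H) * g (E * inverse H))"
    unfolding sum_subtractf sum_distrib_left[symmetric] sum_mult_char_delta by (simp add: X_def mult_ac)
  finally have 1: "(\<Sum>s\<in>UNIV. \<Sum>t\<in>UNIV. T s t)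
      = (q - 1) * (g (D * c) * g (E * c)) * (\<sigma> H / q * ?W - (q - 1) / q * (X * g (D * inverse H) * g (E * inverse H)))
      + (q - 1) * q * (q - 1) * \<sigma> (D * E) * X" .
  \<comment> \<open>Two deltas sit at t = 1/H, one from the first Barnes lemma and one from
    reflecting g(H t). They cancel because E/H and D/H are the inverses of the nontrivial D c and E
    c.\<close>
  have "g (D * c) * g (E * c) * ((q - 1) / q * (X * g (D * inverse H) * g (E * inverse H)))
      = (q - 1) / q * X * (g (D * c) * g (E * inverse H)) * (g (E * c) * g (D * inverse H))"
    by (simp add: mult_ac)
  also have "\<dots> = (q - 1) * q * X * \<sigma> (D * E)"
    unfolding gDc gEc \<sigma>[symmetric] by simp
  finally have X: "g (D * c) * g (E * c) * ((q - 1) / q * (X * g (D * inverse H) * g (E * inverse H)))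
      = (q - 1) * q * X * \<sigma> (D * E)" .
  have 2: "(\<Sum>s\<in>UNIV. \<Sum>t\<in>UNIV. T s t) = (q - 1) * (g (D * c) * g (E * c)) * (\<sigma> H / q * ?W)"
    unfolding 1 right_diff_distrib mult.assoc[of "q - 1" "g (D * c) * g (E * c)"] X
    by (simp add: algebra_simps)

  \<comment> \<open>The delta of the inner sum picks out s = c, where g(c/s) = g(1) = -1; this gives
    the term subtracted in the conclusion.\<close>
  have "(\<Sum>s\<in>UNIV. \<Sum>t\<in>UNIV. T s t) = (\<Sum>s\<in>UNIV. (q - 1) * (g (C * e) * g (C * f))
        * (g (D * s) * g (E * s) * g (e * inverse s) * g (f * inverse s))
      + (q - 1) * q * (q - 1)
        * ((g (D * s) * g (E * s) * g (c * inverse s) * \<sigma> (inverse s * C)) * char_delta (c * inverse s)))"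
  proof (intro sum.cong refl)
    fix s
    have c: "inverse s * C * e * f = c * inverse s"
      by (simp add: c_def mult_ac)
    have "(\<Sum>t\<in>UNIV. T s t) = g (D * s) * g (E * s) * g (c * inverse s)
        * (\<Sum>t\<in>UNIV. g (inverse s * t) * g (C * t) * g (e * inverse t) * g (f * inverse t))"
      by (simp add: T_def sum_distrib_left mult_ac)
    also have "\<dots> = (q - 1) * (g (C * e) * g (C * f))
        * (g (D * s) * g (E * s) * g (e * inverse s) * g (f * inverse s))
      + (q - 1) * q * (q - 1)
        * ((g (D * s) * g (E * s) * g (c * inverse s) * \<sigma> (inverse s * C)) * char_delta (c * inverse s))"
      unfolding sum_barnes_first c by (simp add: distrib_left mult_ac)
    finally show "(\<Sum>t\<in>UNIV. T s t) = \<dots>" .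
  qed
  also have "\<dots> = (q - 1) * (g (C * e) * g (C * f)) * ((q - 1) * ?B)
      + (q - 1) * q * (q - 1) * (g (D * c) * g (E * c) * g (c * inverse c) * \<sigma> (inverse c * C))"
    unfolding sum.distrib sum_distrib_left[symmetric] sum_mult_char_delta_inverse sum_barnes_first
    by simp
  also have "\<sigma> (inverse c * C) = \<sigma> (e * f)"
    using char_at_minus_one_squared[of C]
    by (simp add: c_def char_at_times char_at_inverse inverse_char_at_minus_one mult_ac)
  finally have "(q - 1) * (g (D * c) * g (E * c) * (\<sigma> H / q * ?W))
      = (q - 1) * ((q - 1) * (g (C * e) * g (C * f) * ?B - q * \<sigma> (e * f) * g (D * c) * g (E * c)))"
    unfolding 2 by (simp add: gauss_sum_one algebra_simps)
  then have "g (D * c) * g (E * c) * (\<sigma> H / q * ?W)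
      = (q - 1) * (g (C * e) * g (C * f) * ?B - q * \<sigma> (e * f) * g (D * c) * g (E * c))"
    using q_neq_1 unfolding mult_cancel_left right_minus_eq by blast
  then show ?thesis
    unfolding Dc Ec by (simp add: field_simps)
qed

text \<open>With e = \<chi> and f = inverse (A \<chi>) the second Barnes lemma expands the part of the well-poised
  summand involving C, D and E.\<close>

lemma well_poised_product_expansion:
  fixes A C D E :: "'a mult_char"
  defines "H \<equiv> inverse A * C * D * E"
  assumes "\<sigma> A = 1" and "A \<noteq> C * D" and "A \<noteq> C * E"
  shows "(g (C * \<chi>) * g (C * inverse A * inverse \<chi>)) * (g (D * \<chi>) * g (D * inverse A * inverse \<chi>))
        * (g (E * \<chi>) * g (E * inverse A * inverse \<chi>))
    = g (inverse A * D * E) * g (inverse A * C * D) * g (inverse A * C * E)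
        * (\<sigma> H / (q * (q - 1)) * (\<Sum>\<psi>\<in>UNIV. \<sigma> \<psi> * (g (C * \<psi>) * g (D * \<psi>) * g (E * \<psi>) * g (inverse H * inverse \<psi>))
            * (g (inverse \<psi> * \<chi>) * g (inverse \<psi> * inverse A * inverse \<chi>))) + q)
      + q * (q - 1) * char_delta (inverse A * D * E) * (g (C * \<chi>) * g (C * inverse A * inverse \<chi>))"
    (is "?P = ?a3 * ?a1 * ?a2 * (_ * ?W + q) + _ * ?\<delta> * ?c")
proof -
  \<comment> \<open>Since \<chi> f = 1/A, every parameter product outside the factors for C, D and E
    becomes free of \<chi>.\<close>
  define f where "f = inverse A * inverse \<chi>"
  have ef: "\<chi> * f = inverse A" "C * D * \<chi> * f = inverse A * C * D" "C * E * \<chi> * f = inverse A * C * E"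
      "D * E * \<chi> * f = inverse A * D * E" "C * D * E * \<chi> * f = H"
    by (rule mult_char_eqI; simp add: f_def H_def char_at_times char_at_inverse field_simps)+
  have neq: "inverse A * C * D \<noteq> 1" "inverse A * C * E \<noteq> 1"
    using assms(3,4) by (auto simp: mult_char_mult_eq_1_iff mult.assoc)
  have \<sigma>A: "\<sigma> (inverse A) = 1"
    using assms(2) by (simp add: char_at_inverse)
  \<comment> \<open>Clearing the denominator \<open>?a3\<close> puts this factor on the delta term.
    When the delta is nonzero, D E = A, so \<open>?a3\<close> is g(1) = -1 and the sign is A(-1) =
    1.\<close>
  have \<delta>: "?a3 * ?\<delta> * \<sigma> (D * E) = - ?\<delta>"
  proof (cases "inverse A * D * E = 1")
    case True
    then have "D * E = A"
      by (simp add: mult_char_mult_eq_1_iff mult.assoc)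
    with True show ?thesis
      using assms(2) by (simp add: gauss_sum_one char_delta_def)
  qed (simp add: char_delta_def)
  have P: "?P = g (C * \<chi>) * g (C * f) * (g (D * \<chi>) * g (D * f) * g (E * \<chi>) * g (E * f))"
    and W: "?W = (\<Sum>\<psi>\<in>UNIV. \<sigma> \<psi> * (g (C * \<psi>) * g (D * \<psi>) * g (E * \<psi>)
        * g (\<chi> * inverse \<psi>) * g (f * inverse \<psi>) * g (inverse H * inverse \<psi>)))"
    and c: "?c = g (C * \<chi>) * g (C * f)"
    by (simp_all add: f_def mult_ac)
  have "?a1 * ?a2 * \<sigma> H * ?W
      = q * (q - 1) * (g (C * \<chi>) * g (C * f)
          * (g (D * \<chi>) * g (D * f) * g (E * \<chi>) * g (E * f) / ?a3 + q * (q - 1) * \<sigma> (D * E) * ?\<delta>)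
        - q * ?a1 * ?a2)"
    unfolding W using sum_barnes_second[of C D \<chi> f E] neq unfolding ef \<sigma>A by simp
  also have "\<dots> = q * (q - 1) * (?P / ?a3 + q * (q - 1) * \<sigma> (D * E) * ?\<delta> * ?c - q * ?a1 * ?a2)"
    unfolding P unfolding c by (simp add: distrib_left mult_ac)
  finally have "?a1 * ?a2 * (\<sigma> H / (q * (q - 1)) * ?W)
      = ?P / ?a3 + q * (q - 1) * \<sigma> (D * E) * ?\<delta> * ?c - q * ?a1 * ?a2"
    using q_neq_1 by (simp add: field_simps)
  then have "?a3 * (?a1 * ?a2 * (\<sigma> H / (q * (q - 1)) * ?W))
      = ?a3 * (?P / ?a3 + q * (q - 1) * \<sigma> (D * E) * ?\<delta> * ?c - q * ?a1 * ?a2)"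
    by (rule arg_cong)
  also have "\<dots> = ?P + q * (q - 1) * (?a3 * ?\<delta> * \<sigma> (D * E)) * ?c - q * ?a3 * ?a1 * ?a2"
    by (simp add: right_diff_distrib distrib_left mult_ac)
  finally show ?thesis
    unfolding \<delta> by (simp add: algebra_simps)
qed

section \<open>The transformation for unnormalised sums\<close>

lemma well_poised_5F4:
  fixes A B C D E :: "'a mult_char"
  defines "H \<equiv> inverse A * C * D * E"
  assumes "odd CARD('a)" and "\<sigma> A = 1" and "A \<noteq> 1" and "B \<noteq> 1" and "B ^ 2 \<noteq> A"
    and "A \<noteq> C * D" and "A \<noteq> C * E"
  shows "(\<Sum>\<chi>\<in>UNIV. \<sigma> \<chi> * (g (A * \<chi>) * g (inverse \<chi>)) * (g (B * \<chi>) * g (B * inverse A * inverse \<chi>))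
        * ((g (C * \<chi>) * g (C * inverse A * inverse \<chi>)) * (g (D * \<chi>) * g (D * inverse A * inverse \<chi>))
          * (g (E * \<chi>) * g (E * inverse A * inverse \<chi>))))
    = g (inverse A * D * E) * g (inverse A * C * D) * g (inverse A * C * E)
        * (\<sigma> H * \<sigma> B * g B / q\<^sup>2 * (\<Sum>R\<in>{R. R ^ 2 = A}. g R * g (B * inverse R)
            * (\<Sum>\<psi>\<in>UNIV. g (R * inverse B * \<psi>) * g (C * \<psi>) * g (D * \<psi>) * g (E * \<psi>)
              * g (inverse R * inverse \<psi>) * g (inverse H * inverse \<psi>) * g (inverse A * B * inverse \<psi>)
              * g (inverse \<psi>)))
          + q * (\<Sum>\<chi>\<in>UNIV. \<sigma> \<chi> * (g (A * \<chi>) * g (inverse \<chi>)) * (g (B * \<chi>) * g (B * inverse A * inverse \<chi>))))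
      + q * (q - 1) * char_delta (inverse A * D * E)
        * (\<Sum>\<chi>\<in>UNIV. \<sigma> \<chi> * (g (A * \<chi>) * g (inverse \<chi>)) * (g (B * \<chi>) * g (B * inverse A * inverse \<chi>))
          * (g (C * \<chi>) * g (C * inverse A * inverse \<chi>)))"
proof -
  define K where "K \<chi> = \<sigma> \<chi> * (g (A * \<chi>) * g (inverse \<chi>)) * (g (B * \<chi>) * g (B * inverse A * inverse \<chi>))" for \<chi>
  define L where "L \<psi> \<chi> = g (inverse \<psi> * \<chi>) * g (inverse \<psi> * inverse A * inverse \<chi>)" for \<psi> \<chi>
  define c where "c \<chi> = g (C * \<chi>) * g (C * inverse A * inverse \<chi>)" for \<chi>
  define Y where "Y \<psi> = g (C * \<psi>) * g (D * \<psi>) * g (E * \<psi>) * g (inverse H * inverse \<psi>)" for \<psi>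
  define a where "a = g (inverse A * D * E) * g (inverse A * C * D) * g (inverse A * C * E)"
  define Z where "Z R \<psi> = g (R * inverse B * \<psi>) * g (C * \<psi>) * g (D * \<psi>) * g (E * \<psi>)
      * g (inverse R * inverse \<psi>) * g (inverse H * inverse \<psi>) * g (inverse A * B * inverse \<psi>)
      * g (inverse \<psi>)" for R \<psi>
  \<comment> \<open>Dixon's theorem with third parameter 1/\<psi>, available for every
    \<psi>.\<close>
  have dixon: "(\<Sum>\<chi>\<in>UNIV. K \<chi> * L \<psi> \<chi>) = (q - 1) * g (B * inverse \<psi> * inverse A)
      * (\<Sum>R\<in>{R. R ^ 2 = A}. \<sigma> (B * inverse \<psi>) * g R * g B * g (B * inverse R) * g (inverse \<psi>)
          * g (inverse \<psi> * inverse R) * g (R * inverse B * \<psi>) / q)" for \<psi>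
    unfolding K_def L_def using sum_dixon[OF assms(2,4-6), of "inverse \<psi>"] by simp
  have "(\<Sum>\<chi>\<in>UNIV. K \<chi> * (\<Sum>\<psi>\<in>UNIV. \<sigma> \<psi> * Y \<psi> * L \<psi> \<chi>))
      = (\<Sum>\<chi>\<in>UNIV. \<Sum>\<psi>\<in>UNIV. \<sigma> \<psi> * Y \<psi> * (K \<chi> * L \<psi> \<chi>))"
    by (simp add: sum_distrib_left mult_ac)
  also have "\<dots> = (\<Sum>\<psi>\<in>UNIV. \<Sum>\<chi>\<in>UNIV. \<sigma> \<psi> * Y \<psi> * (K \<chi> * L \<psi> \<chi>))"
    by (rule sum.swap)
  also have "\<dots> = (\<Sum>\<psi>\<in>UNIV. \<Sum>R\<in>{R. R ^ 2 = A}. (q - 1) * \<sigma> B * g B / q * (g R * g (B * inverse R) * Z R \<psi>))"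
  proof (rule sum.cong[OF refl])
    fix \<psi>
    have "\<sigma> \<psi> * Y \<psi> * ((q - 1) * g (B * inverse \<psi> * inverse A)
          * (\<sigma> (B * inverse \<psi>) * g R * g B * g (B * inverse R) * g (inverse \<psi>)
          * g (inverse \<psi> * inverse R) * g (R * inverse B * \<psi>) / q))
        = (q - 1) * \<sigma> B * g B / q * (g R * g (B * inverse R) * Z R \<psi>)" for R
    proof -
      \<comment> \<open>The two signs in \<psi> cancel, in accordance with the 4F3 having argument 1
        and the even exponent 4 at \<chi>(-1).\<close>
      have "\<sigma> \<psi> * \<sigma> (B * inverse \<psi>) = \<sigma> B"
        using char_at_minus_one_squared[of \<psi>]
        by (simp add: char_at_times char_at_inverse inverse_char_at_minus_one mult_ac)
      then show ?thesis
        unfolding Y_def Z_def by (simp add: mult_ac flip: \<open>\<sigma> \<psi> * \<sigma> (B * inverse \<psi>) = \<sigma> B\<close>)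
    qed
    then show "(\<Sum>\<chi>\<in>UNIV. \<sigma> \<psi> * Y \<psi> * (K \<chi> * L \<psi> \<chi>))
        = (\<Sum>R\<in>{R. R ^ 2 = A}. (q - 1) * \<sigma> B * g B / q * (g R * g (B * inverse R) * Z R \<psi>))"
      unfolding sum_distrib_left[symmetric] dixon by (simp only: sum_distrib_left)
  qed
  also have "\<dots> = (\<Sum>R\<in>{R. R ^ 2 = A}. \<Sum>\<psi>\<in>UNIV. (q - 1) * \<sigma> B * g B / q * (g R * g (B * inverse R) * Z R \<psi>))"
    by (rule sum.swap)
  also have "\<dots> = (q - 1) * \<sigma> B * g B / q * (\<Sum>R\<in>{R. R ^ 2 = A}. g R * g (B * inverse R) * (\<Sum>\<psi>\<in>UNIV. Z R \<psi>))"
    by (simp only: sum_distrib_left)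
  finally have KW: "(\<Sum>\<chi>\<in>UNIV. K \<chi> * (\<Sum>\<psi>\<in>UNIV. \<sigma> \<psi> * Y \<psi> * L \<psi> \<chi>))
      = (q - 1) * \<sigma> B * g B / q * (\<Sum>R\<in>{R. R ^ 2 = A}. g R * g (B * inverse R) * (\<Sum>\<psi>\<in>UNIV. Z R \<psi>))" .
  have "(\<Sum>\<chi>\<in>UNIV. K \<chi> * (a * (\<sigma> H / (q * (q - 1)) * (\<Sum>\<psi>\<in>UNIV. \<sigma> \<psi> * Y \<psi> * L \<psi> \<chi>) + q)
        + q * (q - 1) * char_delta (inverse A * D * E) * c \<chi>))
      = (\<Sum>\<chi>\<in>UNIV. a * (\<sigma> H / (q * (q - 1))) * (K \<chi> * (\<Sum>\<psi>\<in>UNIV. \<sigma> \<psi> * Y \<psi> * L \<psi> \<chi>)) + a * q * K \<chi>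
        + q * (q - 1) * char_delta (inverse A * D * E) * (K \<chi> * c \<chi>))"
    by (intro sum.cong refl) (simp only: distrib_left mult_ac)
  also have "\<dots> = a * (\<sigma> H / (q * (q - 1))) * (\<Sum>\<chi>\<in>UNIV. K \<chi> * (\<Sum>\<psi>\<in>UNIV. \<sigma> \<psi> * Y \<psi> * L \<psi> \<chi>))
        + a * q * (\<Sum>\<chi>\<in>UNIV. K \<chi>) + q * (q - 1) * char_delta (inverse A * D * E) * (\<Sum>\<chi>\<in>UNIV. K \<chi> * c \<chi>)"
    by (simp only: sum.distrib sum_distrib_left)
  also have "\<dots> = a * (\<sigma> H * \<sigma> B * g B / q\<^sup>2 * (\<Sum>R\<in>{R. R ^ 2 = A}. g R * g (B * inverse R) * (\<Sum>\<psi>\<in>UNIV. Z R \<psi>))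
        + q * (\<Sum>\<chi>\<in>UNIV. K \<chi>)) + q * (q - 1) * char_delta (inverse A * D * E) * (\<Sum>\<chi>\<in>UNIV. K \<chi> * c \<chi>)"
    unfolding KW using q_neq_1 by (simp add: distrib_left power2_eq_square mult_ac)
  finally show ?thesis
    unfolding well_poised_product_expansion[OF assms(3,7,8), folded H_def]
    unfolding K_def L_def c_def Y_def a_def Z_def .
qed

section \<open>The transformation formula\<close>

lemma char_at_minus_one_left_cancel: "\<sigma> \<chi> * (\<sigma> \<chi> * x) = x"
  using char_at_minus_one_squared[of \<chi>] by (simp flip: mult.assoc)

text \<open>A lower parameter A/X contributes g(X/(A \<chi>)) and so pairs with the upper parameter
  X; of the fifth power of \<chi>(-1) one sign is left.\<close>

lemma hypergeom_star_5F4: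
  "hypergeom_star \<theta> [A, B, C, D, E] [A * inverse B, A * inverse C, A * inverse D, A * inverse E] 1
    = (\<Sum>\<chi>\<in>UNIV. \<sigma> \<chi> * (g (A * \<chi>) * g (inverse \<chi>)) * (g (B * \<chi>) * g (B * inverse A * inverse \<chi>))
        * ((g (C * \<chi>) * g (C * inverse A * inverse \<chi>)) * (g (D * \<chi>) * g (D * inverse A * inverse \<chi>))
          * (g (E * \<chi>) * g (E * inverse A * inverse \<chi>))))
      / ((q - 1) * (g A * g B * g C * g D * g E
          * g (inverse A * B) * g (inverse A * C) * g (inverse A * D) * g (inverse A * E)))"
  by (simp add: hypergeom_star_def q_def inverse_mult_char_mult sum_divide_distrib
      char_at_minus_one_left_cancel mult_ac)

lemma hypergeom_star_4F3:
  "hypergeom_star \<theta> [R * inverse B, C, D, E] [R, inverse A * C * D * E, A * inverse B] 1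
    = (\<Sum>\<psi>\<in>UNIV. g (R * inverse B * \<psi>) * g (C * \<psi>) * g (D * \<psi>) * g (E * \<psi>)
        * g (inverse R * inverse \<psi>) * g (inverse (inverse A * C * D * E) * inverse \<psi>)
        * g (inverse A * B * inverse \<psi>) * g (inverse \<psi>))
      / ((q - 1) * (g (R * inverse B) * g C * g D * g E * g (inverse R)
          * g (inverse (inverse A * C * D * E)) * g (inverse A * B)))"
  by (simp add: hypergeom_star_def q_def inverse_mult_char_mult sum_divide_distrib
      char_at_minus_one_left_cancel char_at_minus_one_squared mult_ac)

lemma hypergeom_star_3F2:
  "hypergeom_star \<theta> [A, B, C] [A * inverse B, A * inverse C] 1
    = (\<Sum>\<chi>\<in>UNIV. \<sigma> \<chi> * (g (A * \<chi>) * g (inverse \<chi>)) * (g (B * \<chi>) * g (B * inverse A * inverse \<chi>))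
        * (g (C * \<chi>) * g (C * inverse A * inverse \<chi>)))
      / ((q - 1) * (g A * g B * g C * g (inverse A * B) * g (inverse A * C)))"
  by (simp add: hypergeom_star_def q_def inverse_mult_char_mult sum_divide_distrib
      char_at_minus_one_left_cancel mult_ac)

text \<open>The exponent at \<chi>(-1) is even here, so the argument -1 is what supplies the sign in
  the sum.\<close>

lemma hypergeom_star_2F1_minus_one:
  "hypergeom_star \<theta> [A, B] [A * inverse B] (- 1)
    = (\<Sum>\<chi>\<in>UNIV. \<sigma> \<chi> * (g (A * \<chi>) * g (inverse \<chi>)) * (g (B * \<chi>) * g (B * inverse A * inverse \<chi>)))
      / ((q - 1) * (g A * g B * g (inverse A * B)))"
  by (simp add: hypergeom_star_def q_def inverse_mult_char_mult sum_divide_distrib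
      char_at_minus_one_left_cancel mult_ac)

section \<open>Nonsquare and square A\<close>

lemma well_poised_5F4_not_square:
  assumes "\<sigma> A = - 1"
  shows "hypergeom_star \<theta> [A, B, C, D, E] [A * inverse B, A * inverse C, A * inverse D, A * inverse E] 1 = 0"
proof -
  define h where "h X \<chi> = g (X * \<chi>) * g (X * inverse A * inverse \<chi>)" for X \<chi>
  define f where "f \<chi> = \<sigma> \<chi> * (g (A * \<chi>) * g (inverse \<chi>)) * h B \<chi> * (h C \<chi> * h D \<chi> * h E \<chi>)" for \<chi>
  define \<iota> where "\<iota> \<chi> = inverse A * inverse \<chi>" for \<chi>
  have \<iota>\<iota>: "\<iota> (\<iota> \<chi>) = \<chi>" for \<chi>
    by (rule mult_char_eqI) (simp add: \<iota>_def char_at_times char_at_inverse)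
  then have "bij \<iota>"
    by (intro bij_betwI[where g = \<iota>]) auto
  have "f (\<iota> \<chi>) = - f \<chi>" for \<chi>
  proof -
    have "h X (\<iota> \<chi>) = h X \<chi>" for X
    proof -
      have "X * \<iota> \<chi> = X * inverse A * inverse \<chi>" "X * inverse A * inverse (\<iota> \<chi>) = X * \<chi>"
        by (rule mult_char_eqI; simp add: \<iota>_def char_at_times char_at_inverse)+
      then show ?thesis
        by (simp add: h_def)
    qed
    moreover have "A * \<iota> \<chi> = inverse \<chi>" "inverse (\<iota> \<chi>) = A * \<chi>"
      by (rule mult_char_eqI; simp add: \<iota>_def char_at_times char_at_inverse)+
    moreover have "\<sigma> (\<iota> \<chi>) = - \<sigma> \<chi>"
      using assms by (simp add: \<iota>_def char_at_times char_at_inverse inverse_char_at_minus_one)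
    ultimately show ?thesis
      by (simp add: f_def)
  qed
  moreover have "(\<Sum>\<chi>\<in>UNIV. f \<chi>) = (\<Sum>\<chi>\<in>UNIV. f (\<iota> \<chi>))"
    by (rule sum.reindex_bij_betw[OF \<open>bij \<iota>\<close>, symmetric])
  ultimately have "(\<Sum>\<chi>\<in>UNIV. f \<chi>) = - (\<Sum>\<chi>\<in>UNIV. f \<chi>)"
    by (simp add: sum_negf)
  then have "(\<Sum>\<chi>\<in>UNIV. f \<chi>) = 0"
    by simp
  then show ?thesis
    unfolding hypergeom_star_5F4 f_def h_def by simp
qed

text \<open>Both sides equal q^2, by reflection at R, B/R and A. It exchanges the R-dependent
  factors left by Dixon's theorem for those normalising the 4F3, at a cost that does not depend on R
  and can leave the sum over R.\<close>

lemma gauss_sums_square_root: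
  assumes "R ^ 2 = A" and "A \<noteq> 1" and "B ^ 2 \<noteq> A"
  shows "\<sigma> B * g R * g (B * inverse R) * (g (inverse R) * g (R * inverse B)) = q * g A * g (inverse A)"
proof -
  have "R \<noteq> 1"
    using assms(1,2) by auto
  have "B * inverse R \<noteq> 1"
  proof
    assume "B * inverse R = 1"
    then have "inverse R = inverse B"
      by (simp add: mult_char_mult_eq_1_iff)
    then have "R = B"
      by (metis inverse_mult_char_inverse)
    then show False
      using assms by simp
  qed
  moreover have "inverse (B * inverse R) = R * inverse B"
    by (simp add: inverse_mult_char_mult mult.commute)
  ultimately have B: "g (B * inverse R) * g (R * inverse B) = q * (\<sigma> B * \<sigma> R)"
    using gauss_sum_inverse_nontrivial[of "B * inverse R"]
    by (simp add: char_at_times char_at_inverse inverse_char_at_minus_one)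
  have R: "g R * g (inverse R) = q * \<sigma> R"
    using \<open>R \<noteq> 1\<close> by (rule gauss_sum_inverse_nontrivial)
  have A: "g A * g (inverse A) = q"
    using gauss_sum_inverse_nontrivial[OF assms(2)] mult_char_square_minus_one[OF assms(1)] by simp
  have "\<sigma> B * g R * g (B * inverse R) * (g (inverse R) * g (R * inverse B))
      = \<sigma> B * (g R * g (inverse R)) * (g (B * inverse R) * g (R * inverse B))"
    by (simp only: mult_ac)
  also have "\<dots> = q * q"
    unfolding B R by (simp add: char_at_minus_one_left_cancel char_at_minus_one_squared mult_ac)
  finally show ?thesis
    by (simp add: A mult.assoc)
qed

lemma well_poised_5F4_square:
  fixes A B C D E :: "'a mult_char"
  defines "H \<equiv> A * inverse (C * D * E)"
  assumes "odd CARD('a)" and "\<sigma> A = 1" and "A \<noteq> 1" and "B \<noteq> 1" and "B ^ 2 \<noteq> A"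
    and "A \<noteq> C * D" and "A \<noteq> C * E"
  shows "hypergeom_star \<theta> [A, B, C, D, E] [A * inverse B, A * inverse C, A * inverse D, A * inverse E] 1
    = g (inverse A) * g (inverse A * D * E) * g (inverse A * C * D) * g (inverse A * C * E) * g H
          / (g (inverse A * C) * g (inverse A * D) * g (inverse A * E) * q * \<sigma> H)
          * (\<Sum>R \<in> {R. R ^ 2 = A}.
               hypergeom_star \<theta> [R * inverse B, C, D, E] [R, inverse A * C * D * E, A * inverse B] 1)
        + g (inverse A * D * E) * g (inverse A * C * D) * g (inverse A * C * E) * q
          / (g C * g D * g E * g (inverse A * C) * g (inverse A * D) * g (inverse A * E))
          * hypergeom_star \<theta> [A, B] [A * inverse B] (- 1)
        + q * (q - 1) * char_delta (inverse A * D * E)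
          / (g D * g E * g (inverse E) * g (inverse D))
          * hypergeom_star \<theta> [A, B, C] [A * inverse B, A * inverse C] 1"
proof -
  define Z where "Z R = (\<Sum>\<psi>\<in>UNIV. g (R * inverse B * \<psi>) * g (C * \<psi>) * g (D * \<psi>) * g (E * \<psi>)
        * g (inverse R * inverse \<psi>) * g (inverse (inverse A * C * D * E) * inverse \<psi>)
        * g (inverse A * B * inverse \<psi>) * g (inverse \<psi>))" for R
  define S\<^sub>2 where "S\<^sub>2 = (\<Sum>\<chi>\<in>UNIV. \<sigma> \<chi> * (g (A * \<chi>) * g (inverse \<chi>)) * (g (B * \<chi>) * g (B * inverse A * inverse \<chi>)))"
  define S\<^sub>3 where "S\<^sub>3 = (\<Sum>\<chi>\<in>UNIV. \<sigma> \<chi> * (g (A * \<chi>) * g (inverse \<chi>)) * (g (B * \<chi>) * g (B * inverse A * inverse \<chi>))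
        * (g (C * \<chi>) * g (C * inverse A * inverse \<chi>)))"
  define a where "a = g (inverse A * D * E) * g (inverse A * C * D) * g (inverse A * C * E)"
  define b where "b = g (inverse A * C) * g (inverse A * D) * g (inverse A * E)"
  define d where "d = g C * g D * g E"
  have nz: "b \<noteq> 0" "d \<noteq> 0" "q - 1 \<noteq> 0"
    using q_neq_1 by (simp_all add: b_def d_def)
  have H: "inverse (inverse A * C * D * E) = H"
    by (simp add: H_def inverse_mult_char_mult mult_ac)
  have \<sigma>H: "\<sigma> (inverse A * C * D * E) = \<sigma> H"
    by (simp add: H_def char_at_times char_at_inverse inverse_char_at_minus_one mult_ac)
  have term4: "\<sigma> H * \<sigma> B * g B / q\<^sup>2 * (g R * g (B * inverse R) * Z R)
          / ((q - 1) * (g A * g B * d * g (inverse A * B) * b))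
      = g (inverse A) * g H / (b * q * \<sigma> H)
        * (Z R / ((q - 1) * (g (R * inverse B) * d * g (inverse R) * g H * g (inverse A * B))))"
    if "R ^ 2 = A" for R
  proof -
    have "\<sigma> B * g R * g (B * inverse R) * (g (inverse R) * g (R * inverse B)) = q * g A * g (inverse A)"
      by (rule gauss_sums_square_root) (use that assms in auto)
    then have root: "\<sigma> B * g R * g (B * inverse R) = q * g A * g (inverse A) / (g (inverse R) * g (R * inverse B))"
      by (simp add: field_simps)
    have \<sigma>H': "g (inverse A) * g H / (b * q * \<sigma> H) = \<sigma> H * (g (inverse A) * g H / (b * q))"
      by (simp add: divide_inverse inverse_char_at_minus_one mult_ac)
    have "\<sigma> H * \<sigma> B * g B / q\<^sup>2 * (g R * g (B * inverse R) * Z R)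
          / ((q - 1) * (g A * g B * d * g (inverse A * B) * b))
        = (\<sigma> B * g R * g (B * inverse R)) * (\<sigma> H * g B / q\<^sup>2 * Z R
          / ((q - 1) * (g A * g B * d * g (inverse A * B) * b)))"
      by (simp add: mult_ac)
    also have "\<dots> = \<sigma> H * (g (inverse A) * g H / (b * q))
        * (Z R / ((q - 1) * (g (R * inverse B) * d * g (inverse R) * g H * g (inverse A * B))))"
      unfolding root using nz by (simp add: power2_eq_square mult_ac)
    finally show ?thesis
      unfolding \<sigma>H' .
  qed
  \<comment> \<open>Only A = D E matters, and then D/A = 1/E and E/A = 1/D; this is how g(1/E) and
    g(1/D) come into the denominator.\<close>
  have term3: "q * (q - 1) * char_delta (inverse A * D * E) * S\<^sub>3
        / ((q - 1) * (g A * g B * d * g (inverse A * B) * b))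
      = q * (q - 1) * char_delta (inverse A * D * E) / (g D * g E * g (inverse E) * g (inverse D))
        * (S\<^sub>3 / ((q - 1) * (g A * g B * g C * g (inverse A * B) * g (inverse A * C))))"
  proof (cases "inverse A * D * E = 1")
    case True
    then have "E * (inverse A * D) = 1" "D * (inverse A * E) = 1"
      by (simp_all add: mult_ac)
    then have "inverse A * D = inverse E" "inverse A * E = inverse D"
      by (simp_all only: mult_char_mult_eq_1_iff)
    then show ?thesis
      using nz by (simp add: b_def d_def mult_ac)
  qed (simp add: char_delta_def)
  have "hypergeom_star \<theta> [A, B, C, D, E] [A * inverse B, A * inverse C, A * inverse D, A * inverse E] 1
      = (a * (\<sigma> H * \<sigma> B * g B / q\<^sup>2 * (\<Sum>R\<in>{R. R ^ 2 = A}. g R * g (B * inverse R) * Z R) + q * S\<^sub>2)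
          + q * (q - 1) * char_delta (inverse A * D * E) * S\<^sub>3)
        / ((q - 1) * (g A * g B * d * g (inverse A * B) * b))"
    unfolding hypergeom_star_5F4 well_poised_5F4[OF assms(2-8)] \<sigma>H a_def S\<^sub>2_def S\<^sub>3_def Z_def
    by (simp add: b_def d_def mult_ac)
  also have "\<dots> = a * (\<Sum>R\<in>{R. R ^ 2 = A}. \<sigma> H * \<sigma> B * g B / q\<^sup>2 * (g R * g (B * inverse R) * Z R)
          / ((q - 1) * (g A * g B * d * g (inverse A * B) * b)))
      + a * (q * S\<^sub>2) / ((q - 1) * (g A * g B * d * g (inverse A * B) * b))
      + q * (q - 1) * char_delta (inverse A * D * E) * S\<^sub>3 / ((q - 1) * (g A * g B * d * g (inverse A * B) * b))"
    by (simp only: add_divide_distrib distrib_left sum_distrib_left sum_divide_distrib times_divide_eq_right)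
  also have "(\<Sum>R\<in>{R. R ^ 2 = A}. \<sigma> H * \<sigma> B * g B / q\<^sup>2 * (g R * g (B * inverse R) * Z R)
          / ((q - 1) * (g A * g B * d * g (inverse A * B) * b)))
      = (\<Sum>R\<in>{R. R ^ 2 = A}. g (inverse A) * g H / (b * q * \<sigma> H)
        * (Z R / ((q - 1) * (g (R * inverse B) * d * g (inverse R) * g H * g (inverse A * B)))))"
    by (rule sum.cong) (auto simp only: term4 mem_Collect_eq)
  also have "\<dots> = g (inverse A) * g H / (b * q * \<sigma> H) * (\<Sum>R\<in>{R. R ^ 2 = A}.
      hypergeom_star \<theta> [R * inverse B, C, D, E] [R, inverse A * C * D * E, A * inverse B] 1)"
    unfolding hypergeom_star_4F3 H Z_def sum_distrib_left[symmetric] by (simp add: d_def mult.assoc)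
  also have "a * (q * S\<^sub>2) / ((q - 1) * (g A * g B * d * g (inverse A * B) * b))
      = a * q / (d * b) * hypergeom_star \<theta> [A, B] [A * inverse B] (- 1)"
    unfolding hypergeom_star_2F1_minus_one S\<^sub>2_def[symmetric] by (simp add: mult_ac)
  also note term3
  also have "S\<^sub>3 / ((q - 1) * (g A * g B * g C * g (inverse A * B) * g (inverse A * C)))
      = hypergeom_star \<theta> [A, B, C] [A * inverse B, A * inverse C] 1"
    unfolding hypergeom_star_3F2 S\<^sub>3_def ..
  finally show ?thesis
    by (simp add: a_def b_def d_def mult_ac)
qed

end

theorem theorem4p4:
  fixes \<theta> :: "'a :: {field, finite} \<Rightarrow> complex"
    and A B C D E :: "'a mult_char"
  defines "q \<equiv> (of_nat CARD('a) :: complex)"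
    and "g \<equiv> gauss_sum \<theta>"
    and "F \<equiv> hypergeom_star \<theta>"
  assumes "odd CARD('a)"
    and "additive_char \<theta>" and "\<exists>x. \<theta> x \<noteq> 1"
    and "(\<exists>S. A = S ^ 2) \<longrightarrow>
           A \<noteq> 1 \<and> B \<noteq> 1 \<and> B ^ 2 \<noteq> A \<and> A \<noteq> C * D \<and> A \<noteq> C * E"
  shows
    "F [A, B, C, D, E]
       [A * inverse B, A * inverse C, A * inverse D, A * inverse E] 1 =
     (if \<not> (\<exists>S. A = S ^ 2) then 0
      else
        g (inverse A) * g (inverse A * D * E) * g (inverse A * C * D) * g (inverse A * C * E)
            * g (A * inverse (C * D * E))
          / (g (inverse A * C) * g (inverse A * D) * g (inverse A * E) * q
              * char_at (A * inverse (C * D * E)) (- 1))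
          * (\<Sum>R \<in> {R. R ^ 2 = A}.
               F [R * inverse B, C, D, E] [R, inverse A * C * D * E, A * inverse B] 1)
        + g (inverse A * D * E) * g (inverse A * C * D) * g (inverse A * C * E) * q
          / (g C * g D * g E * g (inverse A * C) * g (inverse A * D) * g (inverse A * E))
          * F [A, B] [A * inverse B] (- 1)
        + q * (q - 1) * char_delta (inverse A * D * E)
          / (g D * g E * g (inverse E) * g (inverse D))
          * F [A, B, C] [A * inverse B, A * inverse C] 1)"
proof -
  interpret nontrivial_additive_char \<theta> q
    by unfold_locales (use assms in auto)
  show ?thesis
  proof (cases "\<exists>S. A = S ^ 2")
    case False
    then have "char_at A (- 1) = - 1"
      by (rule mult_char_not_square_minus_one[OF assms(4)])
    then show ?thesis
      using False well_poised_5F4_not_square by (simp add: F_def)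
  next
    case True
    then have \<sigma>: "char_at A (- 1) = 1"
      using mult_char_square_minus_one by blast
    have "A \<noteq> 1" "B \<noteq> 1" "B ^ 2 \<noteq> A" "A \<noteq> C * D" "A \<noteq> C * E"
      using True assms(7) by blast+
    from well_poised_5F4_square[OF assms(4) \<sigma> this] show ?thesis
      unfolding F_def g_def by (simp only: True not_True_eq_False if_False)
  qed
qed

end
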